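(* There is an algorithm which, given as input any $n\times n$ matrix $D$ in the pre-strict-circular-Robinson class, outputs a $PQ$-tree $\mathcal{T}$ on the leaf set $[n]$ such that $S_{\mathcal{C}_R^*}(D)=\{\rho\circ\pi:\ \rho\in\operatorname{Dih}_n,\ \pi\in S(\mathcal{T})\}$; that is, it solves the strict circular seriation problem.
   Context: $[n]=\{0,\dots,n-1\}$. A dissimilarity matrix is a real $n\times n$ nonnegative symmetric matrix with zero diagonal. Elements $i,j,k,\ell\in[n]$ are cyclically ordered if pairwise distinct and $(j-i \bmod n)<(k-i\bmod n)<(\ell-i \bmod n)$. A dissimilarity matrix $A$ is strict circular Robinson if $A(i,k)>\min\{A(j,k),A(k,\ell)\}$ for all cyclically ordered $i,j,k,\ell$. $D$ is in the pre-strict-circular-Robinson class if $D=\Pi A\Pi^T$ for a permutation matrix $\Pi$ and a strict circular Robinson $A$. $S_{\mathcal{C}_R^*}(D)$ is the set of permutations $\sigma$ of $[n]$ such that the matrix $A$ with $A(\sigma(a),\sigma(b))=D(a,b)$ is strict circular Robinson. $\operatorname{Dih}_n$ is the subgroup of permutations of $[n]$ generated by $\pi_r(i)=n-1-i$ and $\pi_s(i)=i+1\bmod n$. A $PQ$-tree on $[n]$ is a rooted tree whose leaves are the elements of $[n]$ and whose internal nodes, each with an ordered list of children, are of type $P$ or $Q$. $S(\mathcal{T})$ is the set of left-to-right leaf sequences $(y_0,\dots,y_{n-1})$ obtainable from $\mathcal{T}$ by arbitrarily permuting the children of $P$-nodes and/or reversing the order of children of $Q$-nodes; such a sequence is identified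 with the permutation $\pi$ with $\pi(y_k)=k$. *)

theory Defs
  imports "Jordan_Normal_Form.Matrix" "HOL-Algebra.Generated_Groups"
    "HOL-Combinatorics.Permutations" "HOL-Library.Multiset"
begin

section \<open>Strict circular Robinson matrices\<close>

definition dissimilarity_mat :: "nat \<Rightarrow> real mat \<Rightarrow> bool" where
  "dissimilarity_mat n A \<longleftrightarrow>
     A \<in> carrier_mat n n \<and>
     (\<forall>i<n. \<forall>j<n. 0 \<le> A $$ (i, j)) \<and>
     (\<forall>i<n. \<forall>j<n. A $$ (i, j) = A $$ (j, i)) \<and>
     (\<forall>i<n. A $$ (i, i) = 0)"

definition cyclically_ordered :: "nat \<Rightarrow> nat \<Rightarrow> nat \<Rightarrow> nat \<Rightarrow> nat \<Rightarrow> bool" where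
  "cyclically_ordered n i j k l \<longleftrightarrow>
     distinct [i, j, k, l] \<and>
     (int j - int i) mod int n < (int k - int i) mod int n \<and>
     (int k - int i) mod int n < (int l - int i) mod int n"

definition strict_circular_robinson :: "nat \<Rightarrow> real mat \<Rightarrow> bool" where
  "strict_circular_robinson n A \<longleftrightarrow>
     dissimilarity_mat n A \<and>
     (\<forall>i<n. \<forall>j<n. \<forall>k<n. \<forall>l<n. cyclically_ordered n i j k l \<longrightarrow>
        A $$ (i, k) > min (A $$ (j, k)) (A $$ (k, l)))"

definition permutation_mat :: "nat \<Rightarrow> real mat \<Rightarrow> bool" where
  "permutation_mat n M \<longleftrightarrow>
     (\<exists>\<sigma>. \<sigma> permutes {..<n} \<and> M = mat n n (\<lambda>(i, j). if i = \<sigma> j then 1 else 0))"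

definition pre_strict_circular_robinson :: "nat \<Rightarrow> real mat \<Rightarrow> bool" where
  "pre_strict_circular_robinson n D \<longleftrightarrow>
     (\<exists>M A. permutation_mat n M \<and> strict_circular_robinson n A \<and>
        D = M * A * transpose_mat M)"

text \<open>Permutations of $\{0,\dots,n-1\}$ are functions that are the identity outside this set.\<close>

definition strict_circular_orderings :: "nat \<Rightarrow> real mat \<Rightarrow> (nat \<Rightarrow> nat) set" where
  "strict_circular_orderings n D =
     {\<sigma>. \<sigma> permutes {..<n} \<and>
        (\<exists>A \<in> carrier_mat n n. (\<forall>a<n. \<forall>b<n. A $$ (\<sigma> a, \<sigma> b) = D $$ (a, b)) \<and>
           strict_circular_robinson n A)}"

section \<open>The dihedral group\<close>

text \<open>The library's \<open>sym_group\<close> acts on $\{1,\dots,n\}$; here the index set starts at 0.\<close>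

definition perm_group :: "nat \<Rightarrow> (nat \<Rightarrow> nat) monoid" where
  "perm_group n = \<lparr>carrier = {p. p permutes {..<n}}, mult = (\<circ>), one = id\<rparr>"

definition reversal :: "nat \<Rightarrow> nat \<Rightarrow> nat" where
  "reversal n i = (if i < n then n - 1 - i else i)"

definition cyclic_shift :: "nat \<Rightarrow> nat \<Rightarrow> nat" where
  "cyclic_shift n i = (if i < n then (i + 1) mod n else i)"

definition dihedral :: "nat \<Rightarrow> (nat \<Rightarrow> nat) set" where
  "dihedral n = generate (perm_group n) {reversal n, cyclic_shift n}"

lemma group_perm_group: "group (perm_group n)"
proof (rule groupI)
  fix p assume "p \<in> carrier (perm_group n)"
  then show "\<exists>q \<in> carrier (perm_group n). q \<otimes>\<^bsub>perm_group n\<^esub> p = \<one>\<^bsub>perm_group n\<^esub>"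
    by (auto simp: perm_group_def intro!: bexI[of _ "Hilbert_Choice.inv p"] permutes_inv permutes_inv_o)
qed (auto simp: perm_group_def permutes_compose permutes_id comp_assoc)

lemma reversal_permutes: "reversal n permutes {..<n}"
  by (rule bij_imp_permutes, rule bij_betw_byWitness[where f' = "reversal n"])
    (auto simp: reversal_def)

lemma cyclic_shift_permutes: "cyclic_shift n permutes {..<n}"
proof (rule bij_imp_permutes)
  have "inj_on (cyclic_shift n) {..<n}"
    by (rule inj_onI) (auto simp: cyclic_shift_def mod_Suc split: if_splits)
  moreover have "cyclic_shift n ` {..<n} \<subseteq> {..<n}"
    by (auto simp: cyclic_shift_def)
  ultimately show "bij_betw (cyclic_shift n) {..<n} {..<n}"
    by (simp add: bij_betw_def endo_inj_surj)
qed (simp add: cyclic_shift_def)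

section \<open>PQ-trees\<close>

datatype pqtree = Leaf nat | PNode "pqtree list" | QNode "pqtree list"

fun frontier :: "pqtree \<Rightarrow> nat list" where
  "frontier (Leaf a) = [a]"
| "frontier (PNode ts) = concat (map frontier ts)"
| "frontier (QNode ts) = concat (map frontier ts)"

fun internal_nodes_have_children :: "pqtree \<Rightarrow> bool" where
  "internal_nodes_have_children (Leaf a) \<longleftrightarrow> True"
| "internal_nodes_have_children (PNode ts) \<longleftrightarrow>
     ts \<noteq> [] \<and> (\<forall>t \<in> set ts. internal_nodes_have_children t)"
| "internal_nodes_have_children (QNode ts) \<longleftrightarrow>
     ts \<noteq> [] \<and> (\<forall>t \<in> set ts. internal_nodes_have_children t)"

text \<open>An internal node without children would be a leaf of the rooted tree that carries no label.\<close>

definition pq_tree_on :: "nat \<Rightarrow> pqtree \<Rightarrow> bool" where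
  "pq_tree_on n t \<longleftrightarrow>
     internal_nodes_have_children t \<and> distinct (frontier t) \<and> set (frontier t) = {..<n}"

inductive pq_equiv :: "pqtree \<Rightarrow> pqtree \<Rightarrow> bool" where
  leaf: "pq_equiv (Leaf a) (Leaf a)"
| pnode: "list_all2 pq_equiv ts us \<Longrightarrow> mset vs = mset us \<Longrightarrow> pq_equiv (PNode ts) (PNode vs)"
| qnode: "list_all2 pq_equiv ts us \<Longrightarrow> vs = us \<or> vs = rev us \<Longrightarrow> pq_equiv (QNode ts) (QNode vs)"
monos list_all2_mono

definition pq_perms :: "nat \<Rightarrow> pqtree \<Rightarrow> (nat \<Rightarrow> nat) set" where
  "pq_perms n t =
     {\<pi>. \<pi> permutes {..<n} \<and>
        (\<exists>t'. pq_equiv t t' \<and> length (frontier t') = n \<and> (\<forall>k<n. \<pi> (frontier t' ! k) = k))}"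

section \<open>Algorithms with real inputs\<close>

text \<open>
  The model of computation is the real RAM (Blum--Shub--Smale) model, presented as a small
  programming language: exact field arithmetic and comparisons on real numbers, pairing, branching
  and unbounded iteration.  Data are binary trees with real numbers at the leaves.  The only numeric
  constants of a program are integers, since an arbitrary real constant could encode noncomputable
  information.  Truth values follow the convention that \<open>Null\<close> is false and
  anything else is true.
\<close>

datatype data = Null | Num real | Pair data data

datatype operation = Fst | Snd | IsPair | Add | Sub | Mul | Div | Less

definition truth :: "bool \<Rightarrow> data" where
  "truth b = (if b then Num 1 else Null)"

fun apply_op :: "operation \<Rightarrow> data \<Rightarrow> data option" where
  "apply_op Fst (Pair x y) = Some x"
| "apply_op Snd (Pair x y) = Some y"
| "apply_op IsPair (Pair x y) = Some (truth True)"
| "apply_op IsPair (Num r) = Some (truth False)"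
| "apply_op IsPair Null = Some (truth False)"
| "apply_op Add (Pair (Num r) (Num s)) = Some (Num (r + s))"
| "apply_op Sub (Pair (Num r) (Num s)) = Some (Num (r - s))"
| "apply_op Mul (Pair (Num r) (Num s)) = Some (Num (r * s))"
| "apply_op Div (Pair (Num r) (Num s)) = (if s = 0 then None else Some (Num (r / s)))"
| "apply_op Less (Pair (Num r) (Num s)) = Some (truth (r < s))"
| "apply_op _ _ = None"

text \<open>
  A program transforms one datum into another: \<open>Fork p q\<close> runs both programs on the same input and
  pairs the results, \<open>Cond b p q\<close> and \<open>While b p\<close> run \<open>b\<close> on the current datum as
  a test without changing that datum.
\<close>

datatype program =
    Skip
  | ConstNull
  | ConstInt int
  | Op operation
  | Seq program program
  | Fork program program
  | Cond program program program
  | While program program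

text \<open>\<open>runs p x y\<close>: on input \<open>x\<close>, the program \<open>p\<close> terminates without error and outputs \<open>y\<close>.\<close>

inductive runs :: "program \<Rightarrow> data \<Rightarrow> data \<Rightarrow> bool" where
  Skip: "runs Skip x x"
| ConstNull: "runs ConstNull x Null"
| ConstInt: "runs (ConstInt c) x (Num (of_int c))"
| Op: "apply_op f x = Some y \<Longrightarrow> runs (Op f) x y"
| Seq: "runs p x y \<Longrightarrow> runs q y z \<Longrightarrow> runs (Seq p q) x z"
| Fork: "runs p x y \<Longrightarrow> runs q x z \<Longrightarrow> runs (Fork p q) x (Pair y z)"
| CondTrue: "runs b x v \<Longrightarrow> v \<noteq> Null \<Longrightarrow> runs p x y \<Longrightarrow> runs (Cond b p q) x y"
| CondFalse: "runs b x Null \<Longrightarrow> runs q x y \<Longrightarrow> runs (Cond b p q) x y"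
| WhileStop: "runs b x Null \<Longrightarrow> runs (While b p) x x"
| WhileStep: "runs b x v \<Longrightarrow> v \<noteq> Null \<Longrightarrow> runs p x y \<Longrightarrow> runs (While b p) y z \<Longrightarrow>
    runs (While b p) x z"

lemma runs_deterministic: "runs p x y \<Longrightarrow> runs p x z \<Longrightarrow> y = z"
proof (induction arbitrary: z rule: runs.induct)
  case (Skip x) then show ?case by (auto elim: runs.cases)
next
  case (ConstNull x) then show ?case by (auto elim: runs.cases)
next
  case (ConstInt c x) then show ?case by (auto elim: runs.cases)
next
  case (Op f x y) then show ?case by (auto elim: runs.cases)
next
  case (Seq p x y q z) from Seq.prems Seq.IH show ?case by cases blast
next
  case (Fork p x y q z) from Fork.prems Fork.IH show ?case by cases blast
next
  case (CondTrue b x v p y q) from CondTrue.prems CondTrue.IH CondTrue.hyps show ?case by cases blast+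
next
  case (CondFalse b x q y p) from CondFalse.prems CondFalse.IH show ?case by cases blast+
next
  case (WhileStop b x p) from WhileStop.prems WhileStop.IH show ?case by cases blast+
next
  case (WhileStep b x v p y z) from WhileStep.prems WhileStep.IH WhileStep.hyps show ?case by cases blast+
qed

fun encode_list :: "data list \<Rightarrow> data" where
  "encode_list [] = Null"
| "encode_list (x # xs) = Pair x (encode_list xs)"

definition encode_mat :: "real mat \<Rightarrow> data" where
  "encode_mat A = encode_list (map (\<lambda>row. encode_list (map Num row)) (mat_to_list A))"

fun encode_pqtree :: "pqtree \<Rightarrow> data" where
  "encode_pqtree (Leaf a) = Pair (Num 0) (Num (real a))"
| "encode_pqtree (PNode ts) = Pair (Num 1) (encode_list (map encode_pqtree ts))"
| "encode_pqtree (QNode ts) = Pair (Num 2) (encode_list (map encode_pqtree ts))"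

text \<open>The encoding loses no information, so the output determines the tree.\<close>

lemma encode_list_inject: "encode_list xs = encode_list ys \<longleftrightarrow> xs = ys"
proof (induction xs arbitrary: ys)
  case Nil show ?case by (cases ys) auto
next
  case (Cons x xs) then show ?case by (cases ys) auto
qed

lemma encode_pqtree_inject: "encode_pqtree s = encode_pqtree t \<Longrightarrow> s = t"
proof (induction s arbitrary: t)
  case (Leaf a) then show ?case by (cases t) auto
next
  case (PNode ss)
  then show ?case
    by (cases t) (auto simp: encode_list_inject intro!: list.inj_map_strong[of ss _ encode_pqtree encode_pqtree])
next
  case (QNode ss)
  then show ?case
    by (cases t) (auto simp: encode_list_inject intro!: list.inj_map_strong[of ss _ encode_pqtree encode_pqtree])
qed

end

theory Submission
  imports Defs "HOL-Library.Sublist" "HOL-Library.More_List"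
begin

text \<open>
  Two of the three cyclic orders of four points are both strict circular Robinson only if the points
  form two close pairs \<open>ab | cd\<close>: \<open>D a b\<close> and \<open>D c d\<close> are smaller than the four
  cross distances.  Comparing such quadruples shows, by removing one point at a time, that two valid
  orders of all points either agree up to rotation and reversal, or arise from each other by
  reversing one block \<open>us\<close> of a division of the circle into two arcs \<open>us\<close>, \<open>vs\<close>
  with at least two points each.  Two divisions of the latter kind must coincide, since otherwise
  their blocks would contain \<open>a, b, c\<close> with \<open>D a b < D a c < D a b\<close>.  Hence
  there are at most two valid orders up to the dihedral group, and a \<open>Q\<close>-node nested in a
  \<open>Q\<close>-node represents them.  As no running time is prescribed, exhaustive search finds the
  block; it is a program because the functions computed by programs are closed under \<open>foldl\<close>.
\<close>

text \<open>The comparison rests on a few configurations of five points. Suppose a removed point x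
  is put back. If the remaining orders agree, the two places of x cut the circle into two arcs: two
  long arcs are impossible, and an arc of one point turns the move of x into the flip of a block of
  two. If the remaining orders differ by a flip, a point x inside one of the two arcs keeps its
  place in that arc. Otherwise only the two gaps between the arcs are left, and x joins the
  complement or the block according to whether it keeps its gap or changes it.

  The same division can be read from different starting points and in both directions. Uniqueness of
  the block is therefore proved for sets of points first and transferred to lists afterwards.

  If no block can be flipped, the search cuts off a single point instead. Reversing one point
  changes nothing, so the same shape of tree and the same correctness statement serve both
  cases.\<close>

section \<open>Cyclic sequences up to rotation and reversal\<close>

definition dihedral_equiv :: "'a list \<Rightarrow> 'a list \<Rightarrow> bool" (infix "\<simeq>" 50) where
  "xs \<simeq> ys \<longleftrightarrow> (\<exists>m. ys = rotate m xs \<or> ys = rotate m (rev xs))"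

lemma rotate_inverse: "\<exists>k. rotate k (rotate m xs) = xs"
proof (cases "xs = []")
  case False
  \<comment> \<open>A multiple of the length that is at least \<open>m\<close> is needed: rotating
    by the difference completes a whole number of turns.\<close>
  then have "m \<le> length xs * m" by (cases xs) auto
  then have "rotate (length xs * m - m) (rotate m xs) = rotate (length xs * m) xs"
    by (simp only: rotate_rotate le_add_diff_inverse2)
  then show ?thesis by (metis mod_mult_self1_is_0 rotate_id)
qed simp

lemma rev_rotate: "\<exists>k. rev (rotate m xs) = rotate k (rev xs)"
  using rotate_rev[of m "rev xs"] by auto

lemma dihedral_equiv_refl [simp]: "xs \<simeq> xs"
  unfolding dihedral_equiv_def by (rule exI[of _ 0]) simp

lemma dihedral_equiv_rev [simp]: "xs \<simeq> rev xs"
  unfolding dihedral_equiv_def by (rule exI[of _ 0]) simp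

lemma dihedral_equiv_append_swap: "xs @ ys \<simeq> ys @ xs"
  unfolding dihedral_equiv_def using rotate_append[of xs ys] by (intro exI[of _ "length xs"]) simp

lemma dihedral_equiv_sym:
  assumes "xs \<simeq> ys"
  shows "ys \<simeq> xs"
proof -
  from assms obtain m ws where ys: "ys = rotate m ws" and ws: "ws = xs \<or> ws = rev xs"
    unfolding dihedral_equiv_def by blast
  obtain k where "ws = rotate k ys" using rotate_inverse[of m ws] ys by metis
  then show ?thesis
    using ws rev_rotate[of k ys] unfolding dihedral_equiv_def by (metis rev_rev_ident)
qed

lemma dihedral_equiv_trans [trans]:
  assumes "xs \<simeq> ys" "ys \<simeq> zs"
  shows "xs \<simeq> zs"
proof -
  from assms(1) obtain m ws where ys: "ys = rotate m ws" and ws: "ws = xs \<or> ws = rev xs"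
    unfolding dihedral_equiv_def by blast
  obtain i where "rev ys = rotate i (rev ws)" using rev_rotate[of m ws] ys by blast
  moreover obtain k where "zs = rotate k ys \<or> zs = rotate k (rev ys)"
    using assms(2) unfolding dihedral_equiv_def by blast
  ultimately have "zs = rotate (k + m) ws \<or> zs = rotate (k + i) (rev ws)"
    using ys by (auto simp: rotate_rotate)
  with ws show ?thesis unfolding dihedral_equiv_def by auto
qed

lemma dihedral_equiv_rev_iff: "rev xs \<simeq> ys \<longleftrightarrow> xs \<simeq> ys" "xs \<simeq> rev ys \<longleftrightarrow> xs \<simeq> ys"
proof -
  have *: "rev us \<simeq> vs" if "us \<simeq> vs" for us vs :: "'a list"
    using dihedral_equiv_trans[OF dihedral_equiv_sym[OF dihedral_equiv_rev] that] .
  from *[of xs ys] *[of "rev xs" ys] show "rev xs \<simeq> ys \<longleftrightarrow> xs \<simeq> ys" by (auto simp only: rev_rev_ident)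
  from *[of ys xs] *[of "rev ys" xs] show "xs \<simeq> rev ys \<longleftrightarrow> xs \<simeq> ys"
    by (metis dihedral_equiv_sym rev_rev_ident)
qed

text \<open>A rotation exchanges the two pieces of a cut. Trading the rotation index for a cut suits
  the arguments about subsequences.\<close>

lemma dihedral_equiv_cases:
  assumes "xs \<simeq> ys"
  obtains us vs where "xs = us @ vs" "ys = vs @ us" | us vs where "rev xs = us @ vs" "ys = vs @ us"
proof -
  have "\<exists>us vs. ws = us @ vs \<and> rotate m ws = vs @ us" for m and ws :: "'a list"
    by (rule exI[of _ "take (m mod length ws) ws"], rule exI[of _ "drop (m mod length ws) ws"])
      (simp add: rotate_drop_take)
  with assms show thesis unfolding dihedral_equiv_def by (metis that)
qed

lemma dihedral_equiv_set: "xs \<simeq> ys \<Longrightarrow> set xs = set ys"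
  by (auto simp: dihedral_equiv_def)

lemma dihedral_equiv_distinct: "xs \<simeq> ys \<Longrightarrow> distinct xs \<longleftrightarrow> distinct ys"
  by (auto simp: dihedral_equiv_def)

text \<open>The point where the cyclic order \<open>ys\<close> is cut open becomes the place of
  insertion in \<open>ws\<close>. This carries a removed point along when the order of the others is
  replaced by an equivalent one.\<close>

lemma dihedral_equiv_Cons_insert:
  assumes "ys \<simeq> ws"
  obtains us vs where "ws = us @ vs" "x # ys \<simeq> us @ x # vs"
proof -
  from assms show thesis
  proof (cases rule: dihedral_equiv_cases)
    case (1 vs us)
    then have "x # ys \<simeq> us @ x # vs"
      using dihedral_equiv_append_swap[of "x # vs" us] by simp
    with 1 show ?thesis by (intro that)
  next
    case (2 vs us)
    then have "rev (x # ys) \<simeq> us @ x # vs"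
      using dihedral_equiv_append_swap[of "vs" "us @ [x]"] by simp
    then have "x # ys \<simeq> us @ x # vs" by (simp only: dihedral_equiv_rev_iff)
    with 2 show ?thesis by (intro that)
  qed
qed

section \<open>Strict circular Robinson orders\<close>

text \<open>View \<open>a\<close>, \<open>b\<close>, \<open>c\<close>, \<open>d\<close> as a cyclic
  quadrilateral: at each endpoint, a diagonal must exceed the shorter of the two sides meeting
  there. These are the four rotations of the defining inequality.\<close>

definition robinson4 :: "('a \<Rightarrow> 'a \<Rightarrow> real) \<Rightarrow> 'a \<Rightarrow> 'a \<Rightarrow> 'a \<Rightarrow> 'a \<Rightarrow> bool" where
  "robinson4 D a b c d \<longleftrightarrow>
     min (D b c) (D c d) < D a c \<and> min (D d a) (D a b) < D c a \<and>
     min (D c d) (D d a) < D b d \<and> min (D a b) (D b c) < D d b"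

text \<open>Since \<open>robinson4\<close> is closed under rotation for symmetric \<open>D\<close>,
  it does not matter where the circle is cut. Quantifying over subsequences makes the property pass
  to sublists at once.\<close>

definition robinson_order :: "('a \<Rightarrow> 'a \<Rightarrow> real) \<Rightarrow> 'a list \<Rightarrow> bool" where
  "robinson_order D xs \<longleftrightarrow> (\<forall>a b c d. subseq [a, b, c, d] xs \<longrightarrow> robinson4 D a b c d)"

lemma robinson_orderD: "robinson_order D xs \<Longrightarrow> subseq [a, b, c, d] xs \<Longrightarrow> robinson4 D a b c d"
  by (simp add: robinson_order_def)

lemma robinson_order_subseq: "robinson_order D ys \<Longrightarrow> subseq xs ys \<Longrightarrow> robinson_order D xs"
  unfolding robinson_order_def by (meson subseq_order.trans)

section \<open>Subsequences and their positions\<close>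

lemma subseq_append_mono: "subseq xs xs' \<Longrightarrow> subseq ys ys' \<Longrightarrow> subseq (xs @ ys) (xs' @ ys')"
  by (rule list_emb_append_mono)

lemma subseq_rev: "subseq xs ys \<Longrightarrow> subseq (rev xs) (rev ys)"
  by (induction rule: list_emb.induct) (auto intro: subseq_append_mono subseq_rev_drop_many)

lemma subseq_Cons_append: "a \<in> set us \<Longrightarrow> subseq ws vs \<Longrightarrow> subseq (a # ws) (us @ vs)"
  using subseq_append_mono[of "[a]" us ws vs] by (simp add: subseq_singleton_left)

lemma subseq_pair:
  assumes "2 \<le> length xs"
  obtains a b where "subseq [a, b] xs"
proof -
  from assms obtain a b zs where xs: "xs = a # b # zs"
    by (cases xs; cases "tl xs") auto
  show thesis by (rule that[of a b]) (simp add: xs)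
qed

lemma subseq_pair_total:
  assumes "a \<in> set xs" "b \<in> set xs" "a \<noteq> b"
  shows "subseq [a, b] xs \<or> subseq [b, a] xs"
proof -
  from assms(1) obtain us vs where xs: "xs = us @ a # vs" by (auto simp: in_set_conv_decomp)
  with assms consider "b \<in> set us" | "b \<in> set vs" by auto
  then show ?thesis
  proof cases
    case 1
    then have "subseq [b, a] xs" unfolding xs by (intro subseq_Cons_append) simp_all
    then show ?thesis ..
  next
    case 2
    then have "subseq [a, b] (a # vs)" by (simp add: subseq_singleton_left)
    then have "subseq [a, b] xs" unfolding xs by (rule subseq_drop_many)
    then show ?thesis ..
  qed
qed

text \<open>The suffix after a position serves as a state, so the equivalence can be iterated: four
  uses turn a subsequence of length four into four increasing indices.\<close>

lemma subseq_Cons_drop: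
  "subseq (w # ws) (drop p xs) \<longleftrightarrow>
     (\<exists>m. p \<le> m \<and> m < length xs \<and> xs ! m = w \<and> subseq ws (drop (Suc m) xs))"
proof (induction "length xs - p" arbitrary: p)
  case 0
  then show ?case by simp
next
  case (Suc n)
  then have p: "p < length xs" by simp
  then have drop: "drop p xs = xs ! p # drop (Suc p) xs" by (simp add: Cons_nth_drop_Suc)
  have IH: "subseq (w # ws) (drop (Suc p) xs) \<longleftrightarrow>
     (\<exists>m. Suc p \<le> m \<and> m < length xs \<and> xs ! m = w \<and> subseq ws (drop (Suc m) xs))"
    using Suc by simp
  show ?case
  proof (cases "w = xs ! p")
    case True
    have "subseq ws (drop (Suc m) xs) \<Longrightarrow> p \<le> m \<Longrightarrow> subseq ws (drop (Suc p) xs)" for m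
      using subseq_drop_many[of ws "drop (Suc m) xs" "take (m - p) (drop (Suc p) xs)"]
        append_take_drop_id[of "m - p" "drop (Suc p) xs"] by simp
    with True p show ?thesis unfolding drop by auto
  next
    case False
    then have "subseq (w # ws) (drop p xs) \<longleftrightarrow> subseq (w # ws) (drop (Suc p) xs)"
      unfolding drop by simp
    with False show ?thesis unfolding IH by (metis Suc_leD Suc_leI le_neq_implies_less)
  qed
qed

lemma robinson_order_iff_nth:
  "robinson_order D xs \<longleftrightarrow>
     (\<forall>i j k l. i < j \<and> j < k \<and> k < l \<and> l < length xs \<longrightarrow>
        robinson4 D (xs ! i) (xs ! j) (xs ! k) (xs ! l))"
proof -
  have *: "subseq [a, b, c, d] xs \<longleftrightarrow>
     (\<exists>i j k l. i < j \<and> j < k \<and> k < l \<and> l < length xs \<and> xs ! i = a \<and> xs ! j = b \<and> xs ! k = c \<and> xs ! l = d)"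
    (is "_ \<longleftrightarrow> ?R a b c d") for a b c d
  proof -
    have "subseq [a, b, c, d] (drop 0 xs) \<longleftrightarrow> ?R a b c d"
      unfolding subseq_Cons_drop Suc_le_eq
    proof (intro iffI; elim exE conjE)
      fix i j k l
      assume *: "i < j" "j < k" "k < l" "l < length xs" "xs ! i = a" "xs ! j = b" "xs ! k = c" "xs ! l = d"
      then have "i < length xs" "j < length xs" "k < length xs" by simp_all
      then show "\<exists>i\<ge>0. i < length xs \<and> xs ! i = a \<and>
          (\<exists>j>i. j < length xs \<and> xs ! j = b \<and>
            (\<exists>k>j. k < length xs \<and> xs ! k = c \<and>
              (\<exists>l>k. l < length xs \<and> xs ! l = d \<and> subseq [] (drop (Suc l) xs))))"
        by (intro exI[of _ i] conjI exI[of _ j] exI[of _ k] exI[of _ l]) (use * in simp_all)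
    qed (rule exI, rule exI, rule exI, rule exI, intro conjI)
    then show ?thesis by simp
  qed
  show ?thesis unfolding robinson_order_def * by blast
qed

section \<open>Symmetric functions: dihedral invariance and forbidden patterns on five
  points\<close>

locale symmetric_function =
  fixes D :: "'a \<Rightarrow> 'a \<Rightarrow> real"
  assumes sym: "D x y = D y x"
begin

lemma robinson4_rotate: "robinson4 D b c d a \<longleftrightarrow> robinson4 D a b c d"
  unfolding robinson4_def by (auto simp: sym)

lemma robinson4_rev: "robinson4 D d c b a \<longleftrightarrow> robinson4 D a b c d"
  unfolding robinson4_def by (auto simp: sym min.commute)

text \<open>A quadruple can be divided between the two parts in five ways, and exchanging the parts
  only rotates it.\<close>

lemma robinson_order_append_swap:
  assumes "robinson_order D (xs @ ys)"
  shows "robinson_order D (ys @ xs)"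
  unfolding robinson_order_def
proof (intro allI impI)
  fix a b c d
  assume "subseq [a, b, c, d] (ys @ xs)"
  then obtain us vs where *: "[a, b, c, d] = us @ vs" "subseq us ys" "subseq vs xs"
    unfolding subseq_append_iff by blast
  then have "subseq (vs @ us) (xs @ ys)" by (intro subseq_append_mono)
  then have goal: "robinson4 D a b c d" if "vs @ us = [w, x, y, z]" "robinson4 D w x y z \<longleftrightarrow> robinson4 D a b c d" for w x y z
    using that robinson_orderD[OF assms, of w x y z] by (simp only:)
  from *(1) have "us = [] \<and> vs = [a, b, c, d] \<or> us = [a] \<and> vs = [b, c, d] \<or> us = [a, b] \<and> vs = [c, d] \<or>
      us = [a, b, c] \<and> vs = [d] \<or> us = [a, b, c, d] \<and> vs = []"
    by (auto simp: Cons_eq_append_conv)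
  then show "robinson4 D a b c d"
  proof (elim disjE, goal_cases)
    case 1 then show ?thesis by (intro goal[of a b c d]) simp_all
  next
    case 2 then show ?thesis by (intro goal[of b c d a]) (simp_all only: append.simps robinson4_rotate)
  next
    case 3 then show ?thesis
      by (intro goal[of c d a b]) (simp_all only: append.simps robinson4_rotate[of c d a b] robinson4_rotate[of b c d a])
  next
    case 4 then show ?thesis by (intro goal[of d a b c]) (simp_all only: append.simps robinson4_rotate[of a b c d, symmetric])
  next
    case 5 then show ?thesis by (intro goal[of a b c d]) simp_all
  qed
qed

lemma robinson_order_rev:
  assumes xs: "robinson_order D xs"
  shows "robinson_order D (rev xs)"
  unfolding robinson_order_def
proof (intro allI impI)
  fix a b c d
  assume "subseq [a, b, c, d] (rev xs)"
  then have "subseq (rev [a, b, c, d]) xs"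
    by (metis subseq_rev rev_rev_ident)
  with xs show "robinson4 D a b c d"
    using robinson4_rev[of d c b a] robinson_orderD[OF xs, of d c b a] by simp
qed

lemma robinson_order_cong:
  assumes "xs \<simeq> ys"
  shows "robinson_order D xs \<longleftrightarrow> robinson_order D ys"
proof -
  have "robinson_order D zs" if "ws \<simeq> zs" "robinson_order D ws" for ws zs
    using that(1)
  proof (cases rule: dihedral_equiv_cases)
    case (1 us vs)
    with that(2) show ?thesis by (auto intro: robinson_order_append_swap)
  next
    case (2 us vs)
    with robinson_order_rev[OF that(2)] show ?thesis by (auto intro: robinson_order_append_swap)
  qed
  with assms dihedral_equiv_sym show ?thesis by blast
qed

text \<open>The two cyclic orders share the sides \<open>ab\<close> and \<open>cd\<close>; the other
  two sides of one are the diagonals of the other. Two cross distances p, q with a common endpoint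
  then satisfy p > min q s and q > min p s for a shared side s. The smaller of p and q must exceed
  s, hence both do.\<close>

lemma robinson4_ambiguous:
  assumes "robinson4 D a b c d" "robinson4 D b a c d"
  shows "D a b < D a c" "D a b < D a d" "D a b < D b c" "D a b < D b d"
    "D c d < D a c" "D c d < D a d" "D c d < D b c" "D c d < D b d"
  using assms sym[of b a] sym[of c a] sym[of d a] sym[of c b] sym[of d b] sym[of d c]
  unfolding robinson4_def min_def by (auto split: if_splits)

text \<open>Without \<open>q'\<close> the close pairs are \<open>p p'\<close> and
  \<open>q x\<close>, so \<open>x\<close> is nearer to \<open>q\<close> than to \<open>p\<close>.
  Without \<open>p'\<close> they are \<open>x p\<close> and \<open>q q'\<close>, which gives the
  opposite.\<close>

lemma no_two_block_swap:
  assumes "robinson_order D [x, p, p', q, q']" "robinson_order D [x, q, q', p, p']"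
  shows False
proof -
  have "robinson4 D x p p' q" "robinson4 D x p q q'" "robinson4 D x q p p'" "robinson4 D x q q' p"
    using assms by (auto intro: robinson_orderD)
  then have "robinson4 D p p' q x" "robinson4 D p' p q x" "robinson4 D x p q q'" "robinson4 D p x q q'"
    using robinson4_rotate robinson4_rev by blast+
  from robinson4_ambiguous[OF this(1,2)] robinson4_ambiguous[OF this(3,4)]
  show False using sym[of q x] sym[of p x] by linarith
qed

text \<open>The flip of \<open>a a'\<close> against \<open>b b'\<close> makes \<open>D a a'\<close>
  smaller than \<open>D a b\<close> and \<open>D a' b\<close>. Each of the excluded places of
  \<open>x\<close> makes the quadruple \<open>a\<close>, \<open>a'\<close>, \<open>x\<close>,
  \<open>b\<close> ambiguous as well, with \<open>a b\<close> or \<open>a' b\<close> as a close pair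
  and \<open>a a'\<close> as a cross distance.\<close>

lemma flipped_block_keeps_insertion:
  assumes "robinson_order D [a, x, a', b, b']"
  shows "\<not> robinson_order D [x, a', a, b, b']" "\<not> robinson_order D [a', a, x, b, b']"
    "\<not> robinson_order D [a', a, b, x, b']"
proof -
  have y: "robinson4 D a x a' b" "robinson4 D a a' b b'" "robinson4 D a x a' b'"
    "robinson4 D a x b b'" "robinson4 D x a' b b'"
    using assms by (auto intro: robinson_orderD)
  note flip = robinson4_ambiguous[OF y(2)]
  note sym' = sym[of a' a] sym[of x a] sym[of x a'] sym[of b a] sym[of b a'] sym[of b x]
  show "\<not> robinson_order D [x, a', a, b, b']"
  proof
    assume "robinson_order D [x, a', a, b, b']"
    then have z: "robinson4 D x a' a b" "robinson4 D a' a b b'" by (auto intro: robinson_orderD)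
    have "robinson4 D x a' b a" "robinson4 D a' x b a"
      using y(1) z(1) robinson4_rotate robinson4_rev by blast+
    from robinson4_ambiguous[OF this] flip[OF z(2)] sym' show False by linarith
  qed
  show "\<not> robinson_order D [a', a, x, b, b']"
  proof
    assume "robinson_order D [a', a, x, b, b']"
    then have z: "robinson4 D a' a x b" "robinson4 D a' a b b'" by (auto intro: robinson_orderD)
    have "robinson4 D a x a' b" "robinson4 D x a a' b"
      using y(1) z(1) robinson4_rotate robinson4_rev by blast+
    from robinson4_ambiguous[OF this] flip[OF z(2)] sym' show False by linarith
  qed
  show "\<not> robinson_order D [a', a, b, x, b']"
  proof
    assume "robinson_order D [a', a, b, x, b']"
    then have z: "robinson4 D a' a b x" "robinson4 D a' a b b'" by (auto intro: robinson_orderD)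
    have "robinson4 D x a' b a" "robinson4 D a' x b a"
      using y(1) z(1) robinson4_rotate robinson4_rev by blast+
    from robinson4_ambiguous[OF this] flip[OF z(2)] sym' show False by linarith
  qed
qed

end

section \<open>Flipping a block\<close>

text \<open>Reversing \<open>us\<close> and reversing \<open>vs\<close> agree up to the dihedral
  group, so neither arc is distinguished. If an arc has at most one point, the flip is itself a
  dihedral change.\<close>

definition flip_equiv :: "'a list \<Rightarrow> 'a list \<Rightarrow> bool" where
  "flip_equiv xs ys \<longleftrightarrow>
     (\<exists>us vs. 2 \<le> length us \<and> 2 \<le> length vs \<and> xs \<simeq> us @ vs \<and> ys \<simeq> rev us @ vs)"

lemma flip_equivI:
  "xs \<simeq> us @ vs \<Longrightarrow> ys \<simeq> rev us @ vs \<Longrightarrow> 2 \<le> length us \<Longrightarrow> 2 \<le> length vs \<Longrightarrow> flip_equiv xs ys"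
  unfolding flip_equiv_def by blast

text \<open>On an oriented circle of distinct points, a nonempty proper arc has only one starting
  point. A proper rotation would begin with \<open>hd qs\<close> in \<open>us\<close> and end with
  \<open>last ps\<close> in \<open>vs\<close>, while its cut falls inside one of these blocks and
  puts one of the two points on the wrong side.\<close>

lemma rotate_split_unique:
  assumes "distinct (us @ vs)" "us \<noteq> []" "vs \<noteq> []" "us' \<noteq> []" "vs' \<noteq> []"
    and rot: "us' @ vs' = rotate m (us @ vs)" and set: "set us' = set us"
  shows "us' = us \<and> vs' = vs"
proof -
  define k where "k = m mod length (us @ vs)"
  define ps where "ps = take k (us @ vs)"
  define qs where "qs = drop k (us @ vs)"
  have eq: "us @ vs = ps @ qs" and eq': "us' @ vs' = qs @ ps"
    using rot by (simp_all only: ps_def qs_def append_take_drop_id rotate_drop_take k_def)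
  have dist: "distinct (us' @ vs')" using assms(1) rot by simp
  have len: "length us' = length us"
    using dist assms(1) set by (metis distinct_append distinct_card)
  have "set (us' @ vs') = set (us @ vs)" using rot by simp
  with set dist assms(1) have set': "set vs' = set vs" by auto
  show ?thesis
  proof (cases "ps = [] \<or> qs = []")
    case True
    with eq eq' have "us' @ vs' = us @ vs" by auto
    with len show ?thesis by simp
  next
    case False
    then have hd: "hd qs \<in> set us" and last: "last ps \<in> set vs"
      using arg_cong[OF eq', of hd] arg_cong[OF eq', of last] assms(4,5) set set'
      by (auto dest: hd_in_set last_in_set)
    from eq obtain ws where "us = ps @ ws \<and> ws @ vs = qs \<or> us @ ws = ps \<and> vs = ws @ qs"
      by (auto simp: append_eq_append_conv2)
    then show ?thesis
    proof (elim disjE conjE)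
      assume "us = ps @ ws"
      then have "last ps \<in> set us" using False by simp
      with last assms(1) show ?thesis by auto
    next
      assume "vs = ws @ qs"
      then have "hd qs \<in> set vs" using False by simp
      with hd assms(1) show ?thesis by auto
    qed
  qed
qed

section \<open>Comparison of two valid orders\<close>

context symmetric_function
begin

text \<open>A point strictly inside the flipped block moves to its mirror image. Any other gap shows
  one of the three patterns of \<open>flipped_block_keeps_insertion\<close>; the representatives
  \<open>a\<close>, \<open>a'\<close>, \<open>b\<close>, \<open>b'\<close> are chosen according to
  the gap.\<close>

lemma flipped_block_pins_insertion:
  assumes y: "robinson_order D (us @ x # vs @ ws)" and z: "robinson_order D (ps @ x # qs)"
    and eq: "ps @ qs = rev vs @ rev us @ ws"
    and "us \<noteq> []" "vs \<noteq> []" "2 \<le> length ws"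
  shows "ps = rev vs"
proof (rule ccontr)
  assume neq: "ps \<noteq> rev vs"
  have *: False
    if "a \<in> set us" "a' \<in> set vs" "subseq [b, b'] ws"
      "subseq [x, a', a, b, b'] (ps @ x # qs) \<or> subseq [a', a, x, b, b'] (ps @ x # qs) \<or>
       subseq [a', a, b, x, b'] (ps @ x # qs)" for a a' b b'
  proof -
    have "subseq [a, x, a', b, b'] (us @ x # vs @ ws)"
      using that by (intro subseq_Cons_append list_emb_Cons2 subseq_Cons2)
    then show False
      using flipped_block_keeps_insertion robinson_order_subseq y z that(4) by blast
  qed
  obtain b b' where b: "subseq [b, b'] ws" using assms(6) by (rule subseq_pair)
  define a where "a = hd us"
  define a' where "a' = hd vs"
  have a: "a \<in> set us" and a': "a' \<in> set vs" using assms(4,5) by (auto simp: a_def a'_def)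
  from eq obtain rs where "ps @ rs = rev vs \<and> qs = rs @ rev us @ ws \<or> ps = rev vs @ rs \<and> rs @ qs = rev us @ ws"
    by (auto simp: append_eq_append_conv2)
  then consider (left) "ps @ rs = rev vs" "qs = rs @ rev us @ ws" "rs \<noteq> []"
    | (right) "ps = rev vs @ rs" "rs @ qs = rev us @ ws" "rs \<noteq> []"
    using neq by fastforce
  then show False
  proof cases
    case left
    \<comment> \<open>Here \<open>x\<close> stands before some point of \<open>vs\<close>, which is
      taken as \<open>a'\<close> for the first pattern.\<close>
    then have "hd rs \<in> set vs" by (metis Un_iff hd_in_set set_append set_rev)
    moreover have "subseq [x, hd rs, a, b, b'] (ps @ x # qs)"
      unfolding left(2) using left(3) a b
      by (intro subseq_drop_many subseq_Cons2 subseq_Cons_append) auto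
    ultimately show False using * a b by blast
  next
    case right
    from right(2) obtain ts where "rs @ ts = rev us \<and> qs = ts @ ws \<or> rs = rev us @ ts \<and> ts @ qs = ws"
      by (auto simp: append_eq_append_conv2)
    then consider (inside) "rs @ ts = rev us" "qs = ts @ ws" | (boundary) "rs = rev us" "qs = ws"
      | (mid) "rs = rev us @ ts" "ws = ts @ qs" "ts \<noteq> []" "qs \<noteq> []"
      | (last) "rs = rev us @ ws" "qs = []"
      by fastforce
    then show False
    proof cases
      case inside
      \<comment> \<open>Some point of \<open>us\<close> stands before \<open>x\<close> and is taken
        as \<open>a\<close> for the second pattern.\<close>
      then have "hd rs \<in> set us" using right(3) by (metis Un_iff hd_in_set set_append set_rev)
      moreover have "subseq [a', hd rs, x, b, b'] (rev vs @ rs @ x # ts @ ws)"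
        using right(3) a' b by (intro subseq_Cons2 subseq_Cons_append subseq_drop_many[OF b]) auto
      then have "subseq [a', hd rs, x, b, b'] (ps @ x # qs)" unfolding right(1) inside(2) by simp
      ultimately show False using * a' b by blast
    next
      case boundary
      have "subseq [a', a, x, b, b'] (rev vs @ rev us @ x # ws)"
        using a a' b by (intro subseq_Cons2 subseq_Cons_append) auto
      then have "subseq [a', a, x, b, b'] (ps @ x # qs)" unfolding right(1) boundary by simp
      with *[OF a a' b] show False by blast
    next
      case mid
      \<comment> \<open>Points of \<open>ws\<close> on either side of \<open>x\<close> are taken as
        \<open>b\<close> and \<open>b'\<close> for the third pattern.\<close>
      have "subseq [a', a, hd ts, x, hd qs] (rev vs @ rev us @ ts @ x # qs)"
        using a a' mid(3,4) by (intro subseq_Cons2 subseq_Cons_append) (auto simp: subseq_singleton_left)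
      then have "subseq [a', a, hd ts, x, hd qs] (ps @ x # qs)" unfolding right(1) mid(1) by simp
      moreover have "subseq [hd ts, hd qs] ws"
        unfolding mid(2) using mid(3,4) by (intro subseq_Cons_append) (auto simp: subseq_singleton_left)
      ultimately show False using *[OF a a'] by blast
    next
      case last
      \<comment> \<open>The place after the last point is cyclically the place before the first, so
        the first pattern applies.\<close>
      have "robinson_order D (x # ps)" 
        using robinson_order_append_swap[of ps "[x]"] z last(2) by simp
      moreover have "subseq [x, a', a, b, b'] (x # rev vs @ rev us @ ws)"
        using a a' b by (intro subseq_Cons2 subseq_Cons_append) auto
      ultimately have "robinson_order D [x, a', a, b, b']"
        unfolding right(1) last(1) by (rule robinson_order_subseq)
      moreover have "subseq [a, x, a', b, b'] (us @ x # vs @ ws)"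
        using a a' b by (intro subseq_Cons_append subseq_Cons2)
      ultimately show False
        using flipped_block_keeps_insertion(1) robinson_order_subseq y by blast
    qed
  qed
qed

text \<open>If \<open>x\<close> lies strictly inside the block, it is pinned and joins the block. If
  it lies at an end of the block, the pinning lemma is used in reverse: were \<open>x\<close>
  strictly inside an arc of the second order, its place in the first order would be forced to be
  inside too.\<close>

lemma flip_equiv_insert:
  assumes "robinson_order D ys" "robinson_order D zs"
    and ys: "ys \<simeq> us @ x # vs @ ws" and zs: "zs \<simeq> ps @ x # qs"
    and eq: "ps @ qs = rev (us @ vs) @ ws"
    and len: "2 \<le> length (us @ vs)" "2 \<le> length ws"
  shows "flip_equiv ys zs"
proof (cases "us \<noteq> [] \<and> vs \<noteq> []")
  case True
  have "ps = rev vs"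
    using flipped_block_pins_insertion[of us x vs ws ps qs] assms True
    by (simp add: robinson_order_cong[OF ys] robinson_order_cong[OF zs])
  with eq zs have "zs \<simeq> rev (us @ x # vs) @ ws" by simp
  with ys len show ?thesis by (intro flip_equivI[of _ "us @ x # vs" ws]) simp_all
next
  case False
  define as where "as = us @ vs"
  have swap: "us' @ vs' \<simeq> vs' @ us'" for us' vs' :: "'a list" by (rule dihedral_equiv_append_swap)
  from False have ys': "ys \<simeq> x # as @ ws \<or> ys \<simeq> as @ x # ws"
    using ys by (auto simp: as_def)
  from eq obtain rs where rs: "ps @ rs = rev as \<and> qs = rs @ ws \<or> ps = rev as @ rs \<and> rs @ qs = ws"
    unfolding as_def[symmetric] by (auto simp: append_eq_append_conv2)
  have "zs \<simeq> x # rev as @ ws \<or> zs \<simeq> rev as @ x # ws"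
  proof (rule disjE[OF rs]; elim conjE)
    assume *: "ps @ rs = rev as" "qs = rs @ ws"
    show ?thesis
    proof (cases "ps = [] \<or> rs = []")
      case True with * zs show ?thesis by auto
    next
      case ne: False
      \<comment> \<open>The two orders exchange roles. The result would make both \<open>us\<close>
        and \<open>vs\<close> nonempty.\<close>
      have "us = rev rs"
      proof (rule flipped_block_pins_insertion)
        show "robinson_order D (ps @ x # rs @ ws)" using assms(2) * robinson_order_cong[OF zs] by simp
        show "robinson_order D (us @ x # vs @ ws)" using assms(1) robinson_order_cong[OF ys] by simp
        have "rev rs @ rev ps = as" using arg_cong[OF *(1), of rev] by simp
        then show "us @ vs @ ws = rev rs @ rev ps @ ws" by (simp add: as_def)
      qed (use ne len in auto)
      moreover have "length ps + length rs = length us + length vs"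
        using arg_cong[OF *(1), of length] by (simp add: as_def)
      ultimately show ?thesis using ne False by auto
    qed
  next
    assume *: "ps = rev as @ rs" "rs @ qs = ws"
    show ?thesis
    proof (cases "rs = [] \<or> qs = []")
      case True
      with * zs show ?thesis
        using swap[of "rev as @ ws" "[x]"] dihedral_equiv_trans[OF zs, of "x # rev as @ ws"] by auto
    next
      case ne: False
      \<comment> \<open>Up to reversal, \<open>ws\<close> may be regarded as the flipped block, and
        \<open>x\<close> lies strictly inside it. The resulting equation contradicts a count of
        lengths.\<close>
      have "rev ws @ rev vs = rev qs"
      proof (rule flipped_block_pins_insertion)
        show "robinson_order D (rs @ x # qs @ rev as)"
          using assms(2) * robinson_order_cong[OF zs] robinson_order_append_swap[of "rev as" "rs @ x # qs"] by simp
        show "robinson_order D ((rev ws @ rev vs) @ x # rev us)"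
          using robinson_order_rev[of "us @ x # vs @ ws"] assms(1) robinson_order_cong[OF ys] by simp
        show "(rev ws @ rev vs) @ rev us = rev qs @ rev rs @ rev as"
          using arg_cong[OF *(2), of rev] by (simp add: as_def)
      qed (use ne len in \<open>auto simp: as_def\<close>)
      from arg_cong[OF this, of length] have "length ws + length vs = length qs" by simp
      moreover from arg_cong[OF *(2), of length] have "length rs + length qs = length ws" by simp
      ultimately have "length rs = 0" by linarith
      with ne show ?thesis by simp
    qed
  qed
  \<comment> \<open>Two gaps in each order remain. Staying in the same gap adds \<open>x\<close> to
    \<open>ws\<close>, changing the gap adds it to the flipped block.\<close>
  with ys' consider "ys \<simeq> x # as @ ws" "zs \<simeq> x # rev as @ ws" | "ys \<simeq> x # as @ ws" "zs \<simeq> rev as @ x # ws"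
    | "ys \<simeq> as @ x # ws" "zs \<simeq> x # rev as @ ws" | "ys \<simeq> as @ x # ws" "zs \<simeq> rev as @ x # ws" by blast
  then show ?thesis
  proof cases
    case 1
    then have "ys \<simeq> as @ ws @ [x]" "zs \<simeq> rev as @ ws @ [x]"
      using swap[of "[x]" "as @ ws"] swap[of "[x]" "rev as @ ws"]
        dihedral_equiv_trans[of ys "x # as @ ws"] dihedral_equiv_trans[of zs "x # rev as @ ws"] by simp_all
    with len show ?thesis by (intro flip_equivI[of _ as "ws @ [x]"]) (simp_all add: as_def)
  next
    case 2
    with len show ?thesis by (intro flip_equivI[of _ "x # as" ws]) (simp_all add: as_def)
  next
    case 3
    with len show ?thesis by (intro flip_equivI[of _ "as @ [x]" ws]) (simp_all add: as_def)
  next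
    case 4
    with len show ?thesis by (intro flip_equivI[of _ as "x # ws"]) (simp_all add: as_def)
  qed
qed

lemma robinson_orders_flip_equiv:
  assumes "robinson_order D ys" "robinson_order D zs" "distinct ys" "distinct zs" "set ys = set zs"
  shows "ys \<simeq> zs \<or> flip_equiv ys zs"
  using assms
proof (induction ys arbitrary: zs)
  case Nil
  then show ?case by simp
next
  case (Cons x ys)
  have swap: "us' @ vs' \<simeq> vs' @ us'" for us' vs' :: "'a list" by (rule dihedral_equiv_append_swap)
  from Cons.prems(5) obtain us vs where us: "zs = us @ x # vs"
    by (metis in_set_conv_decomp list.set_intros(1))
  define zs' where "zs' = vs @ us"
  have zs: "zs \<simeq> x # zs'" using swap[of us "x # vs"] by (simp add: us zs'_def)
  have rob: "robinson_order D (x # zs')"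
    using Cons.prems(2) robinson_order_cong[OF zs] by blast
  have "ys \<simeq> zs' \<or> flip_equiv ys zs'"
  proof (rule Cons.IH)
    show "robinson_order D ys" "robinson_order D zs'"
      using Cons.prems(1) rob by (auto elim: robinson_order_subseq)
    show "distinct ys" "distinct zs'" "set ys = set zs'"
      using Cons.prems(3-5) unfolding us zs'_def by auto
  qed
  then show ?case
  proof
    assume "ys \<simeq> zs'"
    then have "\<exists>ps qs. x # ys \<simeq> x # ps @ qs \<and> zs' = qs @ ps"
    proof (cases rule: dihedral_equiv_cases)
      case (1 ps qs)
      then show ?thesis by (intro exI[of _ ps] exI[of _ qs]) simp
    next
      case (2 ps qs)
      have "rev (x # ys) \<simeq> x # ps @ qs" using 2 swap[of "rev ys" "[x]"] by simp
      with 2 show ?thesis unfolding dihedral_equiv_rev_iff by blast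
    qed
    then obtain ps qs where pq: "x # ys \<simeq> x # ps @ qs" "zs \<simeq> x # qs @ ps"
      using zs by auto
    \<comment> \<open>\<open>ps\<close> and \<open>qs\<close> are the arcs between the two places of
      \<open>x\<close>. An empty arc means equal places; three points have only one order up to the
      dihedral group; jumping over a single point flips the block formed by it and \<open>x\<close>;
      two longer arcs contradict \<open>no_two_block_swap\<close>.\<close>
    consider "ps = []" | "qs = []" | p q where "ps = [p]" "qs = [q]" | p where "ps = [p]" "2 \<le> length qs"
      | q where "qs = [q]" "2 \<le> length ps" | "2 \<le> length ps" "2 \<le> length qs"
      by (cases ps; cases qs; cases "tl ps"; cases "tl qs") auto
    then show ?case
    proof cases
      case 1
      with pq have "x # ys \<simeq> x # qs @ ps" "zs \<simeq> x # qs @ ps" by simp_all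
      then show ?thesis by (blast intro: dihedral_equiv_trans dihedral_equiv_sym)
    next
      case 2
      with pq have "x # ys \<simeq> x # qs @ ps" "zs \<simeq> x # qs @ ps" by simp_all
      then show ?thesis by (blast intro: dihedral_equiv_trans dihedral_equiv_sym)
    next
      case (3 p q)
      have "rev [x, p, q] \<simeq> [x, q, p]" using swap[of "[q, p]" "[x]"] by simp
      then have "[x, p, q] \<simeq> [x, q, p]" unfolding dihedral_equiv_rev_iff .
      moreover have "x # ys \<simeq> [x, p, q]" "zs \<simeq> [x, q, p]" using 3 pq by simp_all
      ultimately show ?thesis by (blast intro: dihedral_equiv_trans dihedral_equiv_sym)
    next
      case (4 p)
      with pq have "zs \<simeq> rev [x, p] @ qs"
        using dihedral_equiv_trans[of zs "x # qs @ [p]"] swap[of "x # qs" "[p]"] by simp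
      with 4 pq have "flip_equiv (x # ys) zs" by (intro flip_equivI[of _ "[x, p]" qs]) simp_all
      then show ?thesis ..
    next
      case (5 q)
      with pq have "x # ys \<simeq> [q, x] @ ps"
        using dihedral_equiv_trans[of "x # ys" "x # ps @ [q]"] swap[of "x # ps" "[q]"] by simp
      with 5 pq have "flip_equiv (x # ys) zs" by (intro flip_equivI[of _ "[q, x]" ps]) simp_all
      then show ?thesis ..
    next
      case 6
      obtain p p' q q' where sub: "subseq [p, p'] ps" "subseq [q, q'] qs"
        using 6 by (meson subseq_pair)
      have "robinson_order D (x # ps @ qs)" "robinson_order D (x # qs @ ps)"
        using Cons.prems(1,2) robinson_order_cong[OF pq(1)] robinson_order_cong[OF pq(2)] by blast+
      moreover have "subseq [x, p, p', q, q'] (x # ps @ qs)" "subseq [x, q, q', p, p'] (x # qs @ ps)"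
        using subseq_append_mono[OF sub] subseq_append_mono[OF sub(2,1)] by simp_all
      ultimately show ?thesis using no_two_block_swap robinson_order_subseq by blast
    qed
  next
    assume "flip_equiv ys zs'"
    then obtain as bs where ab: "2 \<le> length as" "2 \<le> length bs" "ys \<simeq> as @ bs" "zs' \<simeq> rev as @ bs"
      unfolding flip_equiv_def by blast
    from ab(3) obtain us vs where uv: "as @ bs = us @ vs" "x # ys \<simeq> us @ x # vs"
      by (rule dihedral_equiv_Cons_insert)
    from ab(4) obtain ps qs where pq: "rev as @ bs = ps @ qs" "x # zs' \<simeq> ps @ x # qs"
      by (rule dihedral_equiv_Cons_insert)
    note zs_pq = dihedral_equiv_trans[OF zs pq(2)]
    from uv(1) obtain ws where "as @ ws = us \<and> bs = ws @ vs \<or> as = us @ ws \<and> ws @ bs = vs"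
      by (auto simp: append_eq_append_conv2)
    then have "flip_equiv (x # ys) zs"
    proof (elim disjE conjE)
      assume *: "as = us @ ws" "ws @ bs = vs"
      then have "x # ys \<simeq> us @ x # ws @ bs" using uv(2) by simp
      from flip_equiv_insert[OF Cons.prems(1,2) this zs_pq] pq(1) ab(1,2) *(1) show ?thesis by simp
    next
      assume *: "as @ ws = us" "bs = ws @ vs"
      \<comment> \<open>Here \<open>x\<close> lies in the complement \<open>bs\<close>. Rotating the
        first order and reversing the second makes \<open>bs\<close> the flipped block.\<close>
      have "us @ x # vs \<simeq> ws @ x # vs @ as" using swap[of as "ws @ x # vs"] *(1)[symmetric] by simp
      from dihedral_equiv_trans[OF uv(2) this] have y: "x # ys \<simeq> ws @ x # vs @ as" .
      have "zs \<simeq> rev (ps @ x # qs)" using zs_pq unfolding dihedral_equiv_rev_iff .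
      then have z: "zs \<simeq> rev qs @ x # rev ps" by simp
      have "rev qs @ rev ps = rev (ws @ vs) @ as"
        using arg_cong[OF pq(1), of rev] *(2) by simp
      from flip_equiv_insert[OF Cons.prems(1,2) y z this] ab(1,2) *(2) show ?thesis by simp
    qed
    then show ?case ..
  qed
qed

text \<open>Any second point \<open>b'\<close> of \<open>vs\<close> completes the three points to an
  ambiguous quadruple, in which \<open>a a'\<close> is a close pair. The unknown order inside each
  block accounts for the four cases.\<close>

lemma flipped_blocks_separated:
  assumes "robinson_order D (us @ vs)" "robinson_order D (rev us @ vs)" "2 \<le> length vs" "distinct vs"
    and "a \<in> set us" "a' \<in> set us" "a \<noteq> a'" "b \<in> set vs"
  shows "D a a' < D a b"
proof -
  from assms(3) obtain c d ws where "vs = c # d # ws" by (cases vs; cases "tl vs") auto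
  with assms(4) have "c \<in> set vs" "d \<in> set vs" "c \<noteq> d" by auto
  then obtain b' where b': "b' \<in> set vs" "b' \<noteq> b" by metis
  have *: "D c c' < D c d \<and> D c c' < D c' d \<and> D c c' < D c d' \<and> D c c' < D c' d'"
    if "subseq [c, c'] us" "subseq [d, d'] vs" for c c' d d'
  proof -
    have "robinson4 D c c' d d'"
      using robinson_orderD[OF assms(1)] subseq_append_mono[OF that] by simp
    moreover have "robinson4 D c' c d d'"
      using robinson_orderD[OF assms(2)] subseq_append_mono[OF subseq_rev[OF that(1)] that(2)] by simp
    ultimately show ?thesis using robinson4_ambiguous by blast
  qed
  have "subseq [a, a'] us \<or> subseq [a', a] us" "subseq [b, b'] vs \<or> subseq [b', b] vs"
    using subseq_pair_total[OF assms(5-7)] subseq_pair_total[OF assms(8) b'(1)] b'(2) by auto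
  then show ?thesis
    using *[of a a' b b'] *[of a a' b' b] *[of a' a b b'] *[of a' a b' b] sym[of a' a]
    by (elim disjE) simp_all
qed

text \<open>Among any three of the four intersections of an old with a new block, one is empty, so
  at least two are. Two empty intersections cannot involve a common block, as that block would be
  empty. Hence they are opposite and the divisions agree.\<close>

lemma flipped_block_unique:
  assumes "robinson_order D (us @ vs)" "robinson_order D (rev us @ vs)"
    and "robinson_order D (us' @ vs')" "robinson_order D (rev us' @ vs')"
    and dist: "distinct (us @ vs)" "distinct (us' @ vs')" and set: "set (us @ vs) = set (us' @ vs')"
    and len: "2 \<le> length us" "2 \<le> length vs" "2 \<le> length us'" "2 \<le> length vs'"
  shows "set us' = set us \<or> set us' = set vs"
proof -
  have flip: "robinson_order D (qs @ ps) \<and> robinson_order D (rev qs @ ps)"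
    if "robinson_order D (ps @ qs)" "robinson_order D (rev ps @ qs)" for ps qs
    using robinson_order_append_swap[OF that(1)] robinson_order_rev[OF that(2)] by simp
  have *: "D a a' < D a b" if "a \<in> P" "a' \<in> P" "a \<noteq> a'" "b \<in> Q"
    "P = set us \<and> Q = set vs \<or> P = set vs \<and> Q = set us \<or> P = set us' \<and> Q = set vs' \<or> P = set vs' \<and> Q = set us'"
    for a a' b P Q
    using that(5)
  proof (elim disjE conjE)
    assume "P = set us" "Q = set vs"
    with that dist len show ?thesis by (intro flipped_blocks_separated[OF assms(1,2)]) simp_all
  next
    assume "P = set vs" "Q = set us"
    with that dist len flip[OF assms(1,2)] show ?thesis by (intro flipped_blocks_separated[of vs us]) simp_all
  next
    assume "P = set us'" "Q = set vs'"
    with that dist len show ?thesis by (intro flipped_blocks_separated[OF assms(3,4)]) simp_all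
  next
    assume "P = set vs'" "Q = set us'"
    with that dist len flip[OF assms(3,4)] show ?thesis by (intro flipped_blocks_separated[of vs' us']) simp_all
  qed
  \<comment> \<open>The two labellings of each division make this apply to any three of the four
    intersections.\<close>
  have cross: "P \<inter> P' = {} \<or> P \<inter> Q' = {} \<or> Q \<inter> P' = {}"
    if "P = set us \<and> Q = set vs \<or> P = set vs \<and> Q = set us"
      "P' = set us' \<and> Q' = set vs' \<or> P' = set vs' \<and> Q' = set us'" for P Q P' Q'
  proof (rule ccontr)
    assume "\<not> ?thesis"
    then obtain a b c where abc: "a \<in> P" "a \<in> P'" "b \<in> P" "b \<in> Q'" "c \<in> Q" "c \<in> P'" by blast
    have "P \<inter> Q = {}" "P' \<inter> Q' = {}" using that dist by auto
    then have "a \<noteq> b" "a \<noteq> c" using abc by auto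
    have "D a b < D a c" by (rule *[of _ P _ _ Q]) (use abc that \<open>a \<noteq> b\<close> in blast)+
    moreover have "D a c < D a b" by (rule *[of _ P' _ _ Q']) (use abc that \<open>a \<noteq> c\<close> in blast)+
    ultimately show False by simp
  qed
  have ne: "set us \<noteq> {}" "set vs \<noteq> {}" "set us' \<noteq> {}" "set vs' \<noteq> {}" using len by auto
  have sub: "set us \<subseteq> set us' \<union> set vs'" "set vs \<subseteq> set us' \<union> set vs'"
    "set us' \<subseteq> set us \<union> set vs" "set vs' \<subseteq> set us \<union> set vs"
    using set by auto
  have "set us \<inter> set us' = {} \<and> set vs \<inter> set vs' = {} \<or> set us \<inter> set vs' = {} \<and> set vs \<inter> set us' = {}"
  proof -
    have *: "\<not> (P \<inter> A = {} \<and> P \<inter> B = {})" "\<not> (A \<inter> P = {} \<and> B \<inter> P = {})"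
      if "P \<noteq> {}" "P \<subseteq> A \<union> B" for P A B :: "'a set"
      using that by blast+
    note *(1)[OF ne(1) sub(1)] *(1)[OF ne(2) sub(2)] *(2)[OF ne(3) sub(3)] *(2)[OF ne(4) sub(4)]
    then show ?thesis
      using cross[of "set us" "set vs" "set us'" "set vs'"] cross[of "set us" "set vs" "set vs'" "set us'"]
        cross[of "set vs" "set us" "set us'" "set vs'"] cross[of "set vs" "set us" "set vs'" "set us'"]
      by argo
  qed
  then show ?thesis
  proof (elim disjE conjE)
    assume "set us \<inter> set us' = {}" "set vs \<inter> set vs' = {}"
    with sub have "set us' \<subseteq> set vs" "set vs \<subseteq> set us'" by blast+
    then show ?thesis by blast
  next
    assume "set us \<inter> set vs' = {}" "set vs \<inter> set us' = {}"
    with sub have "set us' \<subseteq> set us" "set us \<subseteq> set us'" by blast+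
    then show ?thesis by blast
  qed
qed

text \<open>A flip that relates \<open>zs\<close> to \<open>us @ vs\<close> uses the same two sets
  of points. \<open>rotate_split_unique\<close> upgrades this to lists: the new blocks are the old
  ones, possibly exchanged or both reversed. In all four cases the flip gives the same order up to
  the dihedral group.\<close>

lemma robinson_orders_with_flip:
  assumes rob: "robinson_order D (us @ vs)" "robinson_order D (rev us @ vs)" "robinson_order D zs"
    and dist: "distinct (us @ vs)" "distinct zs" and set: "set zs = set (us @ vs)"
    and len: "2 \<le> length us" "2 \<le> length vs"
  shows "zs \<simeq> us @ vs \<or> zs \<simeq> rev us @ vs"
proof -
  have swap: "ps @ qs \<simeq> qs @ ps" for ps qs :: "'a list" by (rule dihedral_equiv_append_swap)
  consider "us @ vs \<simeq> zs" | "flip_equiv (us @ vs) zs"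
    using robinson_orders_flip_equiv[OF rob(1,3) dist] set by blast
  then show ?thesis
  proof cases
    case 1
    then show ?thesis by (auto intro: dihedral_equiv_sym)
  next
    case 2
    then obtain us' vs' where len': "2 \<le> length us'" "2 \<le> length vs'"
      and y: "us @ vs \<simeq> us' @ vs'" and z: "zs \<simeq> rev us' @ vs'"
      unfolding flip_equiv_def by blast
    have "set us' = set us \<or> set us' = set vs"
    proof (rule flipped_block_unique)
      show "robinson_order D (us' @ vs')" "robinson_order D (rev us' @ vs')"
        using rob(1,3) robinson_order_cong[OF y] robinson_order_cong[OF z] by blast+
      show "distinct (us' @ vs')" using dist(1) dihedral_equiv_distinct[OF y] by blast
      show "set (us @ vs) = set (us' @ vs')" by (rule dihedral_equiv_set[OF y])
    qed (use rob dist len len' in simp_all)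
    moreover have split: "us' = ps \<and> vs' = qs"
      if "us' @ vs' = rotate m (ps @ qs)" "set us' = set ps" "distinct (ps @ qs)" "2 \<le> length ps" "2 \<le> length qs"
      for m ps qs
      using rotate_split_unique[OF that(3) _ _ _ _ that(1,2)] that(4,5) len' by fastforce
    moreover have split': "us' = qs \<and> vs' = ps"
      if "us' @ vs' = rotate m (ps @ qs)" "set us' = set qs" "distinct (ps @ qs)" "2 \<le> length ps" "2 \<le> length qs"
      for m ps qs
    \<comment> \<open>A rotation by \<open>length qs\<close> exchanges the two blocks and reduces
      this to the previous claim.\<close>
    proof (rule split[of "m + length qs"])
      have "ps @ qs = rotate (length qs) (qs @ ps)" by (simp add: rotate_append)
      with that(1) show "us' @ vs' = rotate (m + length qs) (qs @ ps)" by (simp add: rotate_rotate)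
    qed (use that in auto)
    moreover from y obtain m where m: "us' @ vs' = rotate m (us @ vs) \<or> us' @ vs' = rotate m (rev vs @ rev us)"
      unfolding dihedral_equiv_def by auto
    moreover have rev: "distinct (rev vs @ rev us)" "2 \<le> length (rev vs)" "2 \<le> length (rev us)"
      using dist(1) len by auto
    note S = split[of m us vs, OF _ _ dist(1) len] split'[of m us vs, OF _ _ dist(1) len]
      split[of m "rev vs" "rev us", OF _ _ rev] split'[of m "rev vs" "rev us", OF _ _ rev]
    ultimately have "us' = us \<and> vs' = vs \<or> us' = vs \<and> vs' = us \<or>
        us' = rev us \<and> vs' = rev vs \<or> us' = rev vs \<and> vs' = rev us"
      unfolding set_rev by blast
    then consider "us' = us" "vs' = vs" | "us' = vs" "vs' = us"
      | "us' = rev us" "vs' = rev vs" | "us' = rev vs" "vs' = rev us" by blast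
    then have "rev us' @ vs' \<simeq> rev us @ vs"
    proof cases
      case 1
      then show ?thesis by simp
    next
      case 2
      then show ?thesis using dihedral_equiv_rev[of "rev vs @ us"] by simp
    next
      case 3
      then show ?thesis
        using dihedral_equiv_trans[OF dihedral_equiv_rev[of "us @ rev vs"]] swap[of vs "rev us"] by simp
    next
      case 4
      then show ?thesis using swap[of vs "rev us"] by simp
    qed
    then show ?thesis using dihedral_equiv_trans[OF z] by blast
  qed
qed

end

section \<open>Permutations as sequences\<close>

text \<open>A permutation sends elements to positions, so its inverse lists the elements by
  position. Composition on the left with a dihedral permutation then acts on positions, that is,
  rotates or reverses the list.\<close>

definition sequence_of :: "nat \<Rightarrow> (nat \<Rightarrow> nat) \<Rightarrow> nat list" where
  "sequence_of n \<sigma> = map (Hilbert_Choice.inv \<sigma>) [0..<n]"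

lemma length_sequence_of [simp]: "length (sequence_of n \<sigma>) = n"
  by (simp add: sequence_of_def)

lemma nth_sequence_of [simp]: "k < n \<Longrightarrow> sequence_of n \<sigma> ! k = Hilbert_Choice.inv \<sigma> k"
  by (simp add: sequence_of_def)

lemma set_sequence_of: "\<sigma> permutes {..<n} \<Longrightarrow> set (sequence_of n \<sigma>) = {..<n}"
  using permutes_image[OF permutes_inv, of \<sigma> "{..<n}"] by (simp add: sequence_of_def lessThan_atLeast0)

lemma distinct_sequence_of: "\<sigma> permutes {..<n} \<Longrightarrow> distinct (sequence_of n \<sigma>)"
  by (simp add: card_distinct set_sequence_of)

lemma sequence_of_eq_iff:
  assumes "\<sigma> permutes {..<n}" "length xs = n"
  shows "sequence_of n \<sigma> = xs \<longleftrightarrow> (\<forall>k<n. \<sigma> (xs ! k) = k)"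
proof
  assume "sequence_of n \<sigma> = xs"
  then show "\<forall>k<n. \<sigma> (xs ! k) = k"
    using permutes_inverses(1)[OF assms(1)] by auto
next
  assume "\<forall>k<n. \<sigma> (xs ! k) = k"
  then show "sequence_of n \<sigma> = xs"
    using permutes_inverses(2)[OF assms(1)] assms(2) by (intro nth_equalityI) (auto, metis)
qed

lemma sequence_of_inject:
  assumes "\<sigma> permutes {..<n}" "\<tau> permutes {..<n}" "sequence_of n \<sigma> = sequence_of n \<tau>"
  shows "\<sigma> = \<tau>"
proof -
  have "Hilbert_Choice.inv \<sigma> k = Hilbert_Choice.inv \<tau> k" for k
  proof (cases "k < n")
    case True
    with assms(3) show ?thesis by (metis nth_sequence_of)
  next
    case False
    then show ?thesis
      using permutes_not_in[OF permutes_inv[OF assms(1)], of k] permutes_not_in[OF permutes_inv[OF assms(2)], of k]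
      by simp
  qed
  then show ?thesis by (metis permutes_inv_inv assms(1,2) ext)
qed

lemma sequence_of_surj:
  assumes "distinct xs" "set xs = {..<n}"
  obtains \<pi> where "\<pi> permutes {..<n}" "sequence_of n \<pi> = xs"
proof -
  define f where "f k = (if k < n then xs ! k else k)" for k
  have len: "length xs = n" using assms by (metis card_lessThan distinct_card)
  have "bij_betw f {..<n} {..<n}"
  proof -
    have "bij_betw (\<lambda>k. xs ! k) {..<n} {..<n}"
      using bij_betw_nth[OF assms(1), of "{..<n}" "set xs"] len assms(2) by simp
    then show ?thesis by (rule bij_betw_cong[THEN iffD1, rotated]) (simp add: f_def)
  qed
  then have f: "f permutes {..<n}" by (rule bij_imp_permutes) (simp add: f_def)
  have "sequence_of n (Hilbert_Choice.inv f) = xs"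
    using len permutes_inv_inv[OF f] by (intro nth_equalityI) (simp_all add: f_def)
  with permutes_inv[OF f] that show thesis by blast
qed

lemma sequence_of_reversal:
  assumes "\<sigma> permutes {..<n}"
  shows "sequence_of n (reversal n \<circ> \<sigma>) = rev (sequence_of n \<sigma>)"
proof (subst sequence_of_eq_iff)
  show "reversal n \<circ> \<sigma> permutes {..<n}"
    using assms reversal_permutes by (rule permutes_compose)
  show "\<forall>k<n. (reversal n \<circ> \<sigma>) (rev (sequence_of n \<sigma>) ! k) = k"
    using permutes_inverses(1)[OF assms] by (simp add: rev_nth reversal_def)
qed simp

text \<open>\<open>cyclic_shift\<close> moves every element one position to the right, whereas
  \<open>rotate1\<close> moves the list to the left; the rotation therefore undoes the
  shift.\<close>

lemma sequence_of_cyclic_shift: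
  assumes "\<sigma> permutes {..<n}"
  shows "rotate1 (sequence_of n (cyclic_shift n \<circ> \<sigma>)) = sequence_of n \<sigma>"
proof -
  have perm: "cyclic_shift n \<circ> \<sigma> permutes {..<n}"
    using assms cyclic_shift_permutes by (rule permutes_compose)
  have "\<sigma> (rotate1 (sequence_of n (cyclic_shift n \<circ> \<sigma>)) ! k) = k" if k: "k < n" for k
  proof -
    let ?y = "rotate1 (sequence_of n (cyclic_shift n \<circ> \<sigma>)) ! k"
    have y: "?y = Hilbert_Choice.inv (cyclic_shift n \<circ> \<sigma>) (Suc k mod n)"
      using k by (simp add: nth_rotate1)
    have "cyclic_shift n (\<sigma> ?y) = Suc k mod n"
      unfolding y using permutes_inverses(1)[OF perm, of "Suc k mod n"] by simp
    moreover have "cyclic_shift n k = Suc k mod n" using k by (simp add: cyclic_shift_def)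
    ultimately show ?thesis
      using permutes_inj[OF cyclic_shift_permutes[of n]] by (metis injD)
  qed
  then show ?thesis using sequence_of_eq_iff[OF assms] by (metis length_rotate1 length_sequence_of)
qed

section \<open>The action of the dihedral group on sequences\<close>

lemma reversal_in_dihedral: "reversal n \<in> dihedral n"
  and cyclic_shift_in_dihedral: "cyclic_shift n \<in> dihedral n"
  by (auto simp: dihedral_def intro: generate.incl)

lemma id_in_dihedral: "id \<in> dihedral n"
  using generate.one[of "perm_group n"] by (simp add: dihedral_def perm_group_def)

lemma dihedral_comp: "\<rho> \<in> dihedral n \<Longrightarrow> \<rho>' \<in> dihedral n \<Longrightarrow> \<rho> \<circ> \<rho>' \<in> dihedral n"
  using generate.eng[of \<rho> "perm_group n" _ \<rho>'] by (simp add: dihedral_def perm_group_def)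

lemma generator_comp_sequence_of:
  assumes "h \<in> {reversal n, cyclic_shift n}" "\<pi> permutes {..<n}"
  shows "sequence_of n \<pi> \<simeq> sequence_of n (h \<circ> \<pi>)"
proof -
  from assms(1) consider "h = reversal n" | "h = cyclic_shift n" by blast
  then show ?thesis
  proof cases
    case 1
    then show ?thesis using sequence_of_reversal[OF assms(2)] by simp
  next
    case 2
    then have "rotate 1 (sequence_of n (h \<circ> \<pi>)) = sequence_of n \<pi>"
      using sequence_of_cyclic_shift[OF assms(2)] by simp
    then have "sequence_of n (h \<circ> \<pi>) \<simeq> sequence_of n \<pi>"
      unfolding dihedral_equiv_def by metis
    then show ?thesis by (rule dihedral_equiv_sym)
  qed
qed

text \<open>The claim that \<rho> is a permutation belongs to the induction because a product is
  treated by applying one hypothesis to the composition of the other factor with \<pi>. An inverse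
  is treated by reading the statement for its generator backwards.\<close>

lemma dihedral_comp_sequence_of:
  assumes "\<rho> \<in> dihedral n"
  shows "\<rho> permutes {..<n} \<and>
    (\<forall>\<pi>. \<pi> permutes {..<n} \<longrightarrow> sequence_of n \<pi> \<simeq> sequence_of n (\<rho> \<circ> \<pi>))"
  using assms unfolding dihedral_def
proof (induction rule: generate.induct)
  case one
  then show ?case by (simp add: perm_group_def permutes_id[unfolded id_def])
next
  case (incl h)
  then have "h permutes {..<n}" using reversal_permutes cyclic_shift_permutes by blast
  with generator_comp_sequence_of[OF incl] show ?case by blast
next
  case (inv h)
  interpret group "perm_group n" by (rule group_perm_group)
  define g where "g = inv\<^bsub>perm_group n\<^esub> h"
  have h: "h permutes {..<n}" using inv reversal_permutes cyclic_shift_permutes by blast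
  then have g: "g permutes {..<n}" "h \<circ> g = id"
    using inv_closed[of h] r_inv[of h] by (simp_all add: g_def perm_group_def)
  have "sequence_of n \<pi> \<simeq> sequence_of n (g \<circ> \<pi>)" if \<pi>: "\<pi> permutes {..<n}" for \<pi>
  proof (rule dihedral_equiv_sym)
    have "h \<circ> (g \<circ> \<pi>) = \<pi>" using g(2) by (simp add: comp_assoc[symmetric])
    with generator_comp_sequence_of[OF inv permutes_compose[OF \<pi> g(1)]]
    show "sequence_of n (g \<circ> \<pi>) \<simeq> sequence_of n \<pi>" by simp
  qed
  with g(1) show ?case unfolding g_def by blast
next
  case (eng h\<^sub>1 h\<^sub>2)
  have "sequence_of n \<pi> \<simeq> sequence_of n (h\<^sub>1 \<circ> h\<^sub>2 \<circ> \<pi>)" if \<pi>: "\<pi> permutes {..<n}" for \<pi>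
  proof -
    have "h\<^sub>2 \<circ> \<pi> permutes {..<n}" using \<pi> eng.IH(2) permutes_compose by blast
    then have "sequence_of n (h\<^sub>2 \<circ> \<pi>) \<simeq> sequence_of n (h\<^sub>1 \<circ> (h\<^sub>2 \<circ> \<pi>))" using eng.IH(1) by blast
    moreover have "sequence_of n \<pi> \<simeq> sequence_of n (h\<^sub>2 \<circ> \<pi>)" using \<pi> eng.IH(2) by blast
    ultimately show ?thesis unfolding comp_assoc by (blast intro: dihedral_equiv_trans)
  qed
  moreover have "h\<^sub>1 \<circ> h\<^sub>2 permutes {..<n}" using eng.IH permutes_compose by blast
  moreover have "h\<^sub>1 \<otimes>\<^bsub>perm_group n\<^esub> h\<^sub>2 = h\<^sub>1 \<circ> h\<^sub>2"
    by (simp add: perm_group_def)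
  ultimately show ?case by presburger
qed

text \<open>Each step of the induction absorbs one rotation by composing \<pi> with
  \<open>cyclic_shift n\<close>; injectivity of \<open>rotate1\<close> cancels it on both
  sides.\<close>

lemma rotate_sequence_of:
  assumes "\<sigma> permutes {..<n}" "\<pi> permutes {..<n}" "sequence_of n \<pi> = rotate m (sequence_of n \<sigma>)"
  shows "\<exists>\<rho> \<in> dihedral n. \<sigma> = \<rho> \<circ> \<pi>"
  using assms(2,3)
proof (induction m arbitrary: \<pi>)
  case 0
  then have "\<sigma> = id \<circ> \<pi>" using sequence_of_inject[OF assms(1)] by simp
  with id_in_dihedral show ?case by blast
next
  case (Suc m)
  have perm: "cyclic_shift n \<circ> \<pi> permutes {..<n}"
    using Suc.prems(1) cyclic_shift_permutes by (rule permutes_compose)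
  have "rotate1 (sequence_of n (cyclic_shift n \<circ> \<pi>)) = rotate1 (rotate m (sequence_of n \<sigma>))"
    using Suc.prems by (simp add: sequence_of_cyclic_shift)
  then have "sequence_of n (cyclic_shift n \<circ> \<pi>) = rotate m (sequence_of n \<sigma>)"
    by (rule injD[OF inj_rotate1])
  from Suc.IH[OF perm this] obtain \<rho> where "\<rho> \<in> dihedral n" "\<sigma> = \<rho> \<circ> (cyclic_shift n \<circ> \<pi>)" by blast
  then show ?case
    using dihedral_comp[OF _ cyclic_shift_in_dihedral, of \<rho>] by (metis comp_assoc)
qed

lemma dihedral_equiv_sequence_of:
  assumes \<sigma>: "\<sigma> permutes {..<n}" and \<pi>: "\<pi> permutes {..<n}"
    and eq: "sequence_of n \<sigma> \<simeq> sequence_of n \<pi>"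
  shows "\<exists>\<rho> \<in> dihedral n. \<sigma> = \<rho> \<circ> \<pi>"
proof -
  from eq obtain m where "sequence_of n \<pi> = rotate m (sequence_of n \<sigma>) \<or>
      sequence_of n \<pi> = rotate m (rev (sequence_of n \<sigma>))"
    unfolding dihedral_equiv_def by blast
  then show ?thesis
  proof
    assume "sequence_of n \<pi> = rotate m (sequence_of n \<sigma>)"
    then show ?thesis by (rule rotate_sequence_of[OF \<sigma> \<pi>])
  next
    assume "sequence_of n \<pi> = rotate m (rev (sequence_of n \<sigma>))"
    then have "sequence_of n \<pi> = rotate m (sequence_of n (reversal n \<circ> \<sigma>))"
      by (simp add: sequence_of_reversal[OF \<sigma>])
    then obtain \<rho> where \<rho>: "\<rho> \<in> dihedral n" "reversal n \<circ> \<sigma> = \<rho> \<circ> \<pi>"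
      using rotate_sequence_of[OF permutes_compose[OF \<sigma> reversal_permutes] \<pi>] by blast
    have "reversal n \<circ> reversal n = id" by (auto simp: reversal_def)
    then have "\<sigma> = reversal n \<circ> (reversal n \<circ> \<sigma>)" by (metis comp_assoc id_comp)
    then have "\<sigma> = (reversal n \<circ> \<rho>) \<circ> \<pi>" unfolding \<rho>(2) by (simp add: comp_assoc)
    with dihedral_comp[OF reversal_in_dihedral \<rho>(1)] show ?thesis by blast
  qed
qed

section \<open>Strict circular Robinson matrices as sequences\<close>

text \<open>The value 0 outside the index range makes the function symmetric on all of
  \<open>nat\<close>, as the locale requires, and agrees with the default value in
  \<open>entry\<close>.\<close>

definition entries :: "nat \<Rightarrow> real mat \<Rightarrow> nat \<Rightarrow> nat \<Rightarrow> real" where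
  "entries n D a b = (if a < n \<and> b < n then D $$ (a, b) else 0)"

lemma symmetric_entries: "dissimilarity_mat n D \<Longrightarrow> symmetric_function (entries n D)"
  by unfold_locales (auto simp: entries_def dissimilarity_mat_def)

text \<open>Residues are measured from \<open>i\<close>: indices below \<open>i\<close> are lifted
  by \<open>n\<close> and so come after all indices above it.\<close>

lemma cyclically_ordered_iff:
  assumes "i < n" "j < n" "k < n" "l < n"
  shows "cyclically_ordered n i j k l \<longleftrightarrow>
    i < j \<and> j < k \<and> k < l \<or> j < k \<and> k < l \<and> l < i \<or> k < l \<and> l < i \<and> i < j \<or> l < i \<and> i < j \<and> j < k"
proof -
  have mod: "(int x - int i) mod int n = (if i \<le> x then int x - int i else int x - int i + int n)"
    if "x < n" for x
  proof (cases "i \<le> x")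
    case False
    have "(int x - int i) mod int n = (int x - int i + int n) mod int n" by simp
    also have "\<dots> = int x - int i + int n" using assms(1) that False by (intro mod_pos_pos_trivial) auto
    finally show ?thesis using False by simp
  qed (use that in simp)
  show ?thesis
    unfolding cyclically_ordered_def mod[OF assms(2)] mod[OF assms(3)] mod[OF assms(4)]
    using assms by auto
qed

text \<open>As \<sigma> is a bijection, the matrix required to exist can only be \<open>B\<close>,
  and \<open>B\<close> inherits the dissimilarity conditions from \<open>D\<close>. The four
  inequalities of \<open>robinson4\<close> match the four ways in which a cyclic quadruple can be
  cut into an increasing one.\<close>

lemma strict_circular_orderings_iff:
  assumes D: "dissimilarity_mat n D"
  shows "\<sigma> \<in> strict_circular_orderings n D \<longleftrightarrow>
    \<sigma> permutes {..<n} \<and> robinson_order (entries n D) (sequence_of n \<sigma>)"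
proof (cases "\<sigma> permutes {..<n}")
  case \<sigma>: True
  define B where "B = mat n n (\<lambda>(i, j). D $$ (Hilbert_Choice.inv \<sigma> i, Hilbert_Choice.inv \<sigma> j))"
  have inv: "Hilbert_Choice.inv \<sigma> i < n" if "i < n" for i
    using permutes_in_image[OF permutes_inv[OF \<sigma>], of i] that by simp
  have \<sigma>_lt: "\<sigma> i < n" if "i < n" for i
    using permutes_in_image[OF \<sigma>, of i] that by simp
  have B: "B \<in> carrier_mat n n" "\<forall>a<n. \<forall>b<n. B $$ (\<sigma> a, \<sigma> b) = D $$ (a, b)"
    using \<sigma>_lt permutes_inverses(2)[OF \<sigma>] by (simp_all add: B_def)
  have "A = B" if "A \<in> carrier_mat n n" "\<forall>a<n. \<forall>b<n. A $$ (\<sigma> a, \<sigma> b) = D $$ (a, b)" for A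
  proof (rule eq_matI)
    fix i j assume "i < dim_row B" "j < dim_col B"
    then have ij: "i < n" "j < n" by (simp_all add: B_def)
    show "A $$ (i, j) = B $$ (i, j)"
      using that(2)[rule_format, OF inv inv, OF ij] ij permutes_inverses(1)[OF \<sigma>] by (simp add: B_def)
  qed (use that in \<open>simp_all add: B_def\<close>)
  with B have "\<sigma> \<in> strict_circular_orderings n D \<longleftrightarrow> strict_circular_robinson n B"
    using \<sigma> unfolding strict_circular_orderings_def by blast
  also have "\<dots> \<longleftrightarrow> (\<forall>i<n. \<forall>j<n. \<forall>k<n. \<forall>l<n. cyclically_ordered n i j k l \<longrightarrow>
        min (B $$ (j, k)) (B $$ (k, l)) < B $$ (i, k))"
    using D inv by (auto simp: strict_circular_robinson_def dissimilarity_mat_def B_def)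
  also have "\<dots> \<longleftrightarrow> (\<forall>i j k l. i < j \<and> j < k \<and> k < l \<and> l < n \<longrightarrow> robinson4 (\<lambda>i j. B $$ (i, j)) i j k l)"
    (is "?L \<longleftrightarrow> ?R")
  proof
    assume L: ?L
    show ?R
    proof (intro allI impI, elim conjE)
      fix i j k l assume *: "i < j" "j < k" "k < l" "l < n"
      then have lt: "i < n" "j < n" "k < n" by simp_all
      have "cyclically_ordered n i j k l" "cyclically_ordered n j k l i"
        "cyclically_ordered n k l i j" "cyclically_ordered n l i j k"
        using * lt by (simp_all add: cyclically_ordered_iff)
      then show "robinson4 (\<lambda>i j. B $$ (i, j)) i j k l"
        unfolding robinson4_def
        using L[rule_format, OF lt *(4)] L[rule_format, OF lt(2,3) *(4) lt(1)]
          L[rule_format, OF lt(3) *(4) lt(1,2)] L[rule_format, OF *(4) lt] by (intro conjI)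
    qed
  next
    assume R: ?R
    show ?L
    proof (intro allI impI)
      fix i j k l assume lt: "i < n" "j < n" "k < n" "l < n" and "cyclically_ordered n i j k l"
      then consider "i < j" "j < k" "k < l" | "j < k" "k < l" "l < i"
        | "k < l" "l < i" "i < j" | "l < i" "i < j" "j < k"
        unfolding cyclically_ordered_iff[OF lt] by blast
      then show "min (B $$ (j, k)) (B $$ (k, l)) < B $$ (i, k)"
      proof cases
        case 1
        then show ?thesis using R[rule_format, of i j k l] lt by (simp add: robinson4_def)
      next
        case 2
        then show ?thesis using R[rule_format, of j k l i] lt by (simp add: robinson4_def)
      next
        case 3
        then show ?thesis using R[rule_format, of k l i j] lt by (simp add: robinson4_def)
      next
        case 4
        then show ?thesis using R[rule_format, of l i j k] lt by (simp add: robinson4_def)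
      qed
    qed
  qed
  also have "\<dots> \<longleftrightarrow> robinson_order (entries n D) (sequence_of n \<sigma>)"
  proof -
    have *: "robinson4 (\<lambda>i j. B $$ (i, j)) i j k l \<longleftrightarrow> robinson4 (entries n D) (sequence_of n \<sigma> ! i)
        (sequence_of n \<sigma> ! j) (sequence_of n \<sigma> ! k) (sequence_of n \<sigma> ! l)"
      if "i < n" "j < n" "k < n" "l < n" for i j k l
      using that inv by (simp add: robinson4_def B_def entries_def)
    have "(i < j \<and> j < k \<and> k < l \<and> l < n \<longrightarrow> robinson4 (\<lambda>i j. B $$ (i, j)) i j k l) \<longleftrightarrow>
        (i < j \<and> j < k \<and> k < l \<and> l < n \<longrightarrow> robinson4 (entries n D) (sequence_of n \<sigma> ! i)
          (sequence_of n \<sigma> ! j) (sequence_of n \<sigma> ! k) (sequence_of n \<sigma> ! l))" for i j k l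
    proof (cases "i < j \<and> j < k \<and> k < l \<and> l < n")
      case True
      then have "i < n" "j < n" "k < n" "l < n" by simp_all
      from *[OF this] True show ?thesis by presburger
    qed argo
    then show ?thesis unfolding robinson_order_iff_nth length_sequence_of by presburger
  qed
  finally show ?thesis using \<sigma> by simp
qed (simp add: strict_circular_orderings_def)

lemma permutation_mat_conj:
  assumes "\<tau> permutes {..<n}" "M = mat n n (\<lambda>(i, j). if i = \<tau> j then 1 else 0)"
    and A: "A \<in> carrier_mat n n" and ij: "i < n" "j < n"
  shows "(M * A * transpose_mat M) $$ (i, j) = (A $$ (Hilbert_Choice.inv \<tau> i, Hilbert_Choice.inv \<tau> j) :: real)"
proof -
  have inv: "Hilbert_Choice.inv \<tau> k < n" if "k < n" for k
    using permutes_in_image[OF permutes_inv[OF assms(1)], of k] that by simp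
  have iff: "i = \<tau> k \<longleftrightarrow> k = Hilbert_Choice.inv \<tau> i" for i k
    using permutes_inverses[OF assms(1)] by metis
  have M: "M \<in> carrier_mat n n" "M $$ (i, k) = (if k = Hilbert_Choice.inv \<tau> i then 1 else 0)"
    if "i < n" "k < n" for i k
    using that by (simp_all add: assms(2) iff)
  have dims: "dim_row M = n" "dim_col M = n" "dim_row A = n" "dim_col A = n"
    using A by (simp_all add: assms(2))
  have MA: "(M * A) $$ (i, k) = A $$ (Hilbert_Choice.inv \<tau> i, k)" if "i < n" "k < n" for i k
  proof -
    have "(M * A) $$ (i, k) = (\<Sum>l\<in>{0..<n}. M $$ (i, l) * A $$ (l, k))"
      using that by (simp add: dims scalar_prod_def)
    also have "\<dots> = (\<Sum>l\<in>{0..<n}. if l = Hilbert_Choice.inv \<tau> i then A $$ (l, k) else 0)"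
      using that by (intro sum.cong) (auto simp: M(2))
    also have "\<dots> = A $$ (Hilbert_Choice.inv \<tau> i, k)" using inv[OF that(1)] by simp
    finally show ?thesis .
  qed
  have "(M * A * transpose_mat M) $$ (i, j) = (\<Sum>l\<in>{0..<n}. (M * A) $$ (i, l) * M $$ (j, l))"
    using ij by (simp add: dims scalar_prod_def)
  also have "\<dots> = (\<Sum>l\<in>{0..<n}. if l = Hilbert_Choice.inv \<tau> j then A $$ (Hilbert_Choice.inv \<tau> i, l) else 0)"
    using ij by (intro sum.cong) (auto simp: M(2) MA)
  also have "\<dots> = A $$ (Hilbert_Choice.inv \<tau> i, Hilbert_Choice.inv \<tau> j)" using inv[OF ij(2)] by simp
  finally show ?thesis .
qed

lemma pre_strict_circular_robinsonD:
  assumes "pre_strict_circular_robinson n D"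
  shows "dissimilarity_mat n D" "strict_circular_orderings n D \<noteq> {}"
proof -
  from assms obtain \<tau> M A where \<tau>: "\<tau> permutes {..<n}"
    and M: "M = mat n n (\<lambda>(i, j). if i = \<tau> j then 1 else 0)"
    and A: "strict_circular_robinson n A" and D: "D = M * A * transpose_mat M"
    unfolding pre_strict_circular_robinson_def permutation_mat_def by blast
  have A': "A \<in> carrier_mat n n" "dissimilarity_mat n A"
    using A by (simp_all add: strict_circular_robinson_def dissimilarity_mat_def)
  have entry: "D $$ (i, j) = A $$ (Hilbert_Choice.inv \<tau> i, Hilbert_Choice.inv \<tau> j)" if "i < n" "j < n" for i j
    using permutation_mat_conj[OF \<tau> M A'(1) that] by (simp add: D)
  have inv: "Hilbert_Choice.inv \<tau> k < n" if "k < n" for k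
    using permutes_in_image[OF permutes_inv[OF \<tau>], of k] that by simp
  have "D \<in> carrier_mat n n" unfolding D M by (intro carrier_matI) simp_all
  with A'(2) entry inv show "dissimilarity_mat n D" by (simp add: dissimilarity_mat_def)
  \<comment> \<open>\<open>D\<close> is \<open>A\<close> with its indices relabelled through the
    inverse of \<tau>, so this inverse is a valid ordering of \<open>D\<close>.\<close>
  have "Hilbert_Choice.inv \<tau> \<in> strict_circular_orderings n D"
    unfolding strict_circular_orderings_def using permutes_inv[OF \<tau>] A A'(1) entry by auto
  then show "strict_circular_orderings n D \<noteq> {}" by blast
qed

section \<open>The PQ-tree of a flippable block\<close>

text \<open>
  Up to rotation and reversal, the only freedom is the orientation of \<open>us\<close>: the remaining
  leaves \<open>vs\<close> need no node of their own.
\<close>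

definition block_tree :: "nat list \<Rightarrow> nat list \<Rightarrow> pqtree" where
  "block_tree us vs = QNode (QNode (map Leaf us) # map Leaf vs)"

lemma frontier_map_Leaf [simp]: "concat (map (frontier \<circ> Leaf) xs) = xs"
  by (induction xs) simp_all

lemma pq_equiv_map_Leaf: "list_all2 pq_equiv (map Leaf xs) ts \<longleftrightarrow> ts = map Leaf xs"
proof -
  have leaf: "pq_equiv (Leaf a) t \<longleftrightarrow> t = Leaf a" for a t
    by (auto elim: pq_equiv.cases intro: pq_equiv.leaf)
  show ?thesis by (induction xs arbitrary: ts) (auto simp: list_all2_Cons1 leaf)
qed

lemma pq_equiv_QNode:
  "pq_equiv (QNode ts) t \<longleftrightarrow> (\<exists>us. list_all2 pq_equiv ts us \<and> (t = QNode us \<or> t = QNode (rev us)))"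
  by (subst pq_equiv.simps) auto

lemma pq_equiv_block_tree:
  "pq_equiv (block_tree us vs) t \<longleftrightarrow>
     t = QNode (QNode (map Leaf us) # map Leaf vs) \<or> t = QNode (QNode (map Leaf (rev us)) # map Leaf vs) \<or>
     t = QNode (map Leaf (rev vs) @ [QNode (map Leaf us)]) \<or>
     t = QNode (map Leaf (rev vs) @ [QNode (map Leaf (rev us))])"
  unfolding block_tree_def pq_equiv_QNode list_all2_Cons1 pq_equiv_map_Leaf
  by (auto simp: rev_map)

lemma frontier_block_tree:
  "(\<exists>t. pq_equiv (block_tree us vs) t \<and> frontier t = xs) \<longleftrightarrow>
     xs \<in> {us @ vs, rev us @ vs, rev vs @ us, rev vs @ rev us}"
  unfolding pq_equiv_block_tree conj_disj_distribR ex_disj_distrib by auto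

lemma pq_perms_block_tree:
  assumes "length us + length vs = n"
  shows "\<pi> \<in> pq_perms n (block_tree us vs) \<longleftrightarrow> \<pi> permutes {..<n} \<and>
    sequence_of n \<pi> \<in> {us @ vs, rev us @ vs, rev vs @ us, rev vs @ rev us}"
proof (cases "\<pi> permutes {..<n}")
  case True
  have "(\<exists>t. pq_equiv (block_tree us vs) t \<and> length (frontier t) = n \<and> (\<forall>k<n. \<pi> (frontier t ! k) = k)) \<longleftrightarrow>
      (\<exists>t. pq_equiv (block_tree us vs) t \<and> frontier t = sequence_of n \<pi>)"
    using sequence_of_eq_iff[OF True] by (metis length_sequence_of)
  with True show ?thesis unfolding pq_perms_def mem_Collect_eq frontier_block_tree by blast
qed (simp add: pq_perms_def)

lemma pq_tree_on_block_tree: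
  assumes "us \<noteq> []" "distinct (us @ vs)" "set (us @ vs) = {..<n}"
  shows "pq_tree_on n (block_tree us vs)"
  using assms by (auto simp: pq_tree_on_def block_tree_def)

text \<open>The four frontiers of the tree form the pairs \<open>us @ vs\<close>,
  \<open>rev vs @ rev us\<close> and \<open>rev us @ vs\<close>, \<open>rev vs @ us\<close>, each
  consisting of a list and its reversal. Up to the dihedral group they are thus exactly the two
  orders in the assumptions.\<close>

lemma strict_circular_orderings_block_tree:
  assumes D: "dissimilarity_mat n D"
    and dist: "distinct (us @ vs)" and set: "set (us @ vs) = {..<n}"
    and rob: "robinson_order (entries n D) (us @ vs)" "robinson_order (entries n D) (rev us @ vs)"
    and only: "\<And>zs. robinson_order (entries n D) zs \<Longrightarrow> distinct zs \<Longrightarrow> set zs = {..<n} \<Longrightarrow>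
      zs \<simeq> us @ vs \<or> zs \<simeq> rev us @ vs"
  shows "strict_circular_orderings n D =
    {\<rho> \<circ> \<pi> | \<rho> \<pi>. \<rho> \<in> dihedral n \<and> \<pi> \<in> pq_perms n (block_tree us vs)}"
proof -
  interpret symmetric_function "entries n D" using D by (rule symmetric_entries)
  have len: "length us + length vs = n"
    using dist set by (metis card_lessThan distinct_card length_append)
  note perms = pq_perms_block_tree[OF len]
  have "rev us @ vs \<simeq> rev vs @ us" "us @ vs \<simeq> rev vs @ rev us"
    using dihedral_equiv_rev[of "rev us @ vs"] dihedral_equiv_rev[of "us @ vs"] by simp_all
  with rob have all: "robinson_order (entries n D) xs"
    if "xs \<in> {us @ vs, rev us @ vs, rev vs @ us, rev vs @ rev us}" for xs
    using that robinson_order_cong by blast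
  show ?thesis
  proof (intro equalityI subsetI)
    fix \<sigma> assume "\<sigma> \<in> strict_circular_orderings n D"
    then have \<sigma>: "\<sigma> permutes {..<n}" "robinson_order (entries n D) (sequence_of n \<sigma>)"
      using strict_circular_orderings_iff[OF D] by blast+
    from only[OF \<sigma>(2) distinct_sequence_of[OF \<sigma>(1)] set_sequence_of[OF \<sigma>(1)]]
    obtain xs where xs: "sequence_of n \<sigma> \<simeq> xs" "xs = us @ vs \<or> xs = rev us @ vs" by blast
    have "distinct xs" "set xs = {..<n}" using xs(2) dist set by auto
    then obtain \<pi> where \<pi>: "\<pi> permutes {..<n}" "sequence_of n \<pi> = xs" by (rule sequence_of_surj)
    then have "\<pi> \<in> pq_perms n (block_tree us vs)" using xs(2) unfolding perms by blast
    moreover obtain \<rho> where "\<rho> \<in> dihedral n" "\<sigma> = \<rho> \<circ> \<pi>"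
      using dihedral_equiv_sequence_of[OF \<sigma>(1) \<pi>(1)] xs(1) \<pi>(2) by blast
    ultimately show "\<sigma> \<in> {\<rho> \<circ> \<pi> | \<rho> \<pi>. \<rho> \<in> dihedral n \<and> \<pi> \<in> pq_perms n (block_tree us vs)}" by blast
  next
    fix \<sigma> assume "\<sigma> \<in> {\<rho> \<circ> \<pi> | \<rho> \<pi>. \<rho> \<in> dihedral n \<and> \<pi> \<in> pq_perms n (block_tree us vs)}"
    then obtain \<rho> \<pi> where \<sigma>: "\<sigma> = \<rho> \<circ> \<pi>" "\<rho> \<in> dihedral n" and \<pi>: "\<pi> permutes {..<n}"
      "sequence_of n \<pi> \<in> {us @ vs, rev us @ vs, rev vs @ us, rev vs @ rev us}"
      unfolding perms by blast
    have "sequence_of n \<pi> \<simeq> sequence_of n \<sigma>" "\<rho> permutes {..<n}"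
      using dihedral_comp_sequence_of[OF \<sigma>(2)] \<pi>(1) unfolding \<sigma>(1) by blast+
    then show "\<sigma> \<in> strict_circular_orderings n D"
      using all[OF \<pi>(2)] robinson_order_cong permutes_compose[OF \<pi>(1)]
      unfolding strict_circular_orderings_iff[OF D] \<sigma>(1) by blast
  qed
qed

section \<open>Computable functions\<close>

text \<open>An overloaded encoding lets computability be derived from the shape of an ordinary typed
  term, without writing its program by hand.\<close>

class encodable =
  fixes encode :: "'a \<Rightarrow> data"

instantiation nat :: encodable
begin
definition encode_nat_def: "encode (n :: nat) = Num (real n)"
instance ..
end

instantiation real :: encodable
begin
definition encode_real_def: "encode (r :: real) = Num r"
instance ..
end

instantiation bool :: encodable
begin
definition encode_bool_def: "encode (b :: bool) = truth b"
instance ..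
end

instantiation prod :: (encodable, encodable) encodable
begin
definition encode_prod_def: "encode p = Pair (encode (fst p)) (encode (snd p))"
instance ..
end

instantiation list :: (encodable) encodable
begin
definition encode_list_def: "encode xs = encode_list (map encode xs)"
instance ..
end

instantiation pqtree :: encodable
begin
definition encode_pqtree_def: "encode t = encode_pqtree t"
instance ..
end

lemma encode_Nil: "encode [] = Null"
  and encode_Cons: "encode (x # xs) = Pair (encode x) (encode xs)"
  by (simp_all add: encode_list_def)

text \<open>One program has to halt correctly on every encoded value. Partial operations such as
  list access are therefore totalised by defaults in the search.\<close>

definition computable :: "('a::encodable \<Rightarrow> 'b::encodable) \<Rightarrow> bool" where
  "computable f \<longleftrightarrow> (\<exists>p. \<forall>x. runs p (encode x) (encode (f x)))"

named_theorems computable_intros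

lemma computable_ident [computable_intros]: "computable (\<lambda>x. x)"
  unfolding computable_def by (blast intro: runs.Skip)

lemma computable_comp: "computable g \<Longrightarrow> computable f \<Longrightarrow> computable (\<lambda>x. g (f x))"
  unfolding computable_def by (blast intro: runs.Seq)

lemma computable_Pair [computable_intros]:
  "computable f \<Longrightarrow> computable g \<Longrightarrow> computable (\<lambda>x. (f x, g x))"
  unfolding computable_def encode_prod_def fst_conv snd_conv by (blast intro: runs.Fork)

lemma computable_binary:
  assumes "computable (\<lambda>p. h (fst p) (snd p))" "computable f" "computable g"
  shows "computable (\<lambda>x. h (f x) (g x))"
  using computable_comp[OF assms(1) computable_Pair[OF assms(2,3)]] by simp

lemma computable_Op:
  assumes "\<And>x. apply_op c (encode x) = Some (encode (f x))"
  shows "computable f"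
  unfolding computable_def using assms by (blast intro: runs.Op)

lemma computable_fst [computable_intros]: "computable f \<Longrightarrow> computable (\<lambda>x. fst (f x))"
  by (rule computable_comp[where g = fst]) (rule computable_Op[of Fst], simp add: encode_prod_def)

lemma computable_snd [computable_intros]: "computable f \<Longrightarrow> computable (\<lambda>x. snd (f x))"
  by (rule computable_comp[where g = snd]) (rule computable_Op[of Snd], simp add: encode_prod_def)

lemma computable_const_nat [computable_intros]: "computable (\<lambda>_. c :: nat)"
  unfolding computable_def encode_nat_def using runs.ConstInt[of "int c"] by auto

lemma computable_zero_real [computable_intros]: "computable (\<lambda>_. 0 :: real)"
  unfolding computable_def encode_real_def using runs.ConstInt[of 0] by auto

lemma computable_const_bool [computable_intros]: "computable (\<lambda>_. c :: bool)"
  unfolding computable_def encode_bool_def truth_def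
  using runs.ConstInt[of 1] runs.ConstNull by (cases c) auto

lemma computable_Nil [computable_intros]: "computable (\<lambda>_. [])"
  unfolding computable_def encode_Nil using runs.ConstNull by blast

lemma computable_Cons [computable_intros]:
  "computable f \<Longrightarrow> computable g \<Longrightarrow> computable (\<lambda>x. f x # g x)"
  unfolding computable_def encode_Cons by (blast intro: runs.Fork)

lemma computable_if [computable_intros]:
  assumes "computable b" "computable f" "computable g"
  shows "computable (\<lambda>x. if b x then f x else g x)"
proof -
  from assms obtain pb pf pg where *: "\<And>x. runs pb (encode x) (truth (b x))"
    "\<And>x. runs pf (encode x) (encode (f x))" "\<And>x. runs pg (encode x) (encode (g x))"
    unfolding computable_def encode_bool_def by metis
  have "runs (Cond pb pf pg) (encode x) (encode (if b x then f x else g x))" for x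
  proof (cases "b x")
    case True
    then show ?thesis using *(1)[of x] *(2)[of x] by (auto intro: runs.CondTrue simp: truth_def)
  next
    case False
    then show ?thesis using *(1)[of x] *(3)[of x] by (auto intro: runs.CondFalse simp: truth_def)
  qed
  then show ?thesis unfolding computable_def by blast
qed

lemma computable_not [computable_intros]:
  assumes "computable f"
  shows "computable (\<lambda>x. \<not> f x)"
proof -
  have eq: "(\<lambda>x. \<not> f x) = (\<lambda>x. if f x then False else True)" by auto
  show ?thesis unfolding eq by (intro computable_if computable_const_bool assms)
qed

lemma computable_conj [computable_intros]:
  assumes "computable f" "computable g"
  shows "computable (\<lambda>x. f x \<and> g x)"
proof -
  have eq: "(\<lambda>x. f x \<and> g x) = (\<lambda>x. if f x then g x else False)" by auto
  show ?thesis unfolding eq by (intro computable_if computable_const_bool assms)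
qed

lemma computable_disj [computable_intros]:
  assumes "computable f" "computable g"
  shows "computable (\<lambda>x. f x \<or> g x)"
proof -
  have eq: "(\<lambda>x. f x \<or> g x) = (\<lambda>x. if f x then True else g x)" by auto
  show ?thesis unfolding eq by (intro computable_if computable_const_bool assms)
qed

lemma computable_imp [computable_intros]:
  assumes "computable f" "computable g"
  shows "computable (\<lambda>x. f x \<longrightarrow> g x)"
proof -
  have eq: "(\<lambda>x. f x \<longrightarrow> g x) = (\<lambda>x. if f x then g x else True)" by auto
  show ?thesis unfolding eq by (intro computable_if computable_const_bool assms)
qed

section \<open>Arithmetic and comparisons\<close>

lemma computable_less_nat [computable_intros]:
  "computable f \<Longrightarrow> computable g \<Longrightarrow> computable (\<lambda>x. f x < (g x :: nat))"
  by (rule computable_binary[where h = "(<)"])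
    (rule computable_Op[of Less], simp_all add: encode_prod_def encode_nat_def encode_bool_def)

lemma computable_less_real [computable_intros]:
  "computable f \<Longrightarrow> computable g \<Longrightarrow> computable (\<lambda>x. f x < (g x :: real))"
  by (rule computable_binary[where h = "(<)"])
    (rule computable_Op[of Less], simp_all add: encode_prod_def encode_real_def encode_bool_def)

lemma computable_add_nat [computable_intros]:
  "computable f \<Longrightarrow> computable g \<Longrightarrow> computable (\<lambda>x. f x + (g x :: nat))"
  by (rule computable_binary[where h = "(+)"])
    (rule computable_Op[of Add], simp_all add: encode_prod_def encode_nat_def)

lemma computable_eq_nat [computable_intros]:
  assumes "computable f" "computable g"
  shows "computable (\<lambda>x. f x = (g x :: nat))"
proof -
  have "f x = g x \<longleftrightarrow> \<not> f x < g x \<and> \<not> g x < f x" for x by auto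
  then show ?thesis by (simp only:) (intro computable_intros assms)
qed

text \<open>This is the only rule whose program contains a loop. The state keeps the environment
  \<open>e\<close> beside the accumulator and the remaining list, so that \<open>F\<close> may
  depend on outer variables; nested quantifiers rely on this.\<close>

lemma computable_foldl [computable_intros]:
  assumes F: "computable (\<lambda>p. F (fst p) (fst (snd p)) (snd (snd p)))"
    and g: "computable g" and l: "computable l"
  shows "computable (\<lambda>e. foldl (F e) (g e) (l e))"
proof -
  from assms obtain pF pg pl
    where pF: "\<And>e s x. runs pF (Pair (encode e) (Pair (encode s) (encode x))) (encode (F e s x))"
      and pg: "\<And>e. runs pg (encode e) (encode (g e))"
      and pl: "\<And>e. runs pl (encode e) (encode (l e))"
    unfolding computable_def encode_prod_def by (metis fst_conv snd_conv)
  \<comment> \<open>A nonempty list is encoded by a \<open>Pair\<close> and the empty one by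
    \<open>Null\<close>, so \<open>IsPair\<close> detects remaining elements.\<close>
  define test where "test = Seq (Op Snd) (Seq (Op Snd) (Op IsPair))"
  define step where "step = Fork (Op Fst)
    (Fork (Seq (Fork (Op Fst) (Fork (Seq (Op Snd) (Op Fst)) (Seq (Op Snd) (Seq (Op Snd) (Op Fst))))) pF)
      (Seq (Op Snd) (Seq (Op Snd) (Op Snd))))"
  have loop: "runs (While test step) (Pair (encode e) (Pair (encode s) (encode xs)))
      (Pair (encode e) (Pair (encode (foldl (F e) s xs)) Null))" for e s xs
  proof (induction xs arbitrary: s)
    case Nil
    have "runs test (Pair (encode e) (Pair (encode s) (encode []))) Null"
      unfolding test_def by (rule runs.Seq runs.Op | simp add: encode_Nil truth_def)+
    then show ?case by (simp add: encode_Nil runs.WhileStop)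
  next
    case (Cons x xs)
    let ?state = "Pair (encode e) (Pair (encode s) (encode (x # xs)))"
    have "runs test ?state (Num 1)"
      unfolding test_def encode_Cons by (rule runs.Seq runs.Op | simp add: truth_def)+
    moreover have "runs step ?state (Pair (encode e) (Pair (encode (F e s x)) (encode xs)))"
      unfolding step_def encode_Cons by (rule runs.Fork runs.Seq runs.Op pF | simp)+
    ultimately show ?case using Cons[of "F e s x"] by (auto intro: runs.WhileStep)
  qed
  have "runs (Seq (Fork Skip (Fork pg pl)) (Seq (While test step) (Seq (Op Snd) (Op Fst))))
      (encode e) (encode (foldl (F e) (g e) (l e)))" for e
    by (rule runs.Seq runs.Fork runs.Skip pg pl loop runs.Op | simp)+
  then show ?thesis unfolding computable_def by blast
qed

section \<open>List functions as folds\<close>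

lemma foldl_Cons: "foldl (\<lambda>s x. f x # s) ys xs = rev (map f xs) @ ys"
  by (induction xs arbitrary: ys) simp_all

lemma computable_rev [computable_intros]:
  assumes "computable l"
  shows "computable (\<lambda>e. rev (l e))"
proof -
  have "foldl (\<lambda>s x. x # s) [] xs = rev xs" for xs :: "'b list"
    using foldl_Cons[of "\<lambda>x. x" "[]"] by simp
  note this[symmetric]
  then show ?thesis by (simp only:) (intro computable_intros assms)
qed

lemma computable_append [computable_intros]:
  assumes "computable f" "computable g"
  shows "computable (\<lambda>e. f e @ g e)"
proof -
  have "xs @ ys = foldl (\<lambda>s x. x # s) ys (rev xs)" for xs ys :: "'b list"
    using foldl_Cons[of "\<lambda>x. x" ys "rev xs"] by simp
  then show ?thesis by (simp only:) (intro computable_intros assms)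
qed

lemma computable_map [computable_intros]:
  assumes "computable (\<lambda>p. F (fst p) (snd p))" "computable l"
  shows "computable (\<lambda>e. map (F e) (l e))"
proof -
  have "map (F e) (l e) = rev (foldl (\<lambda>s x. F e x # s) [] (l e))" for e
    by (simp add: foldl_Cons)
  then show ?thesis
    by (simp only:) (intro computable_intros assms computable_binary[where h = F])
qed

lemma computable_concat [computable_intros]:
  assumes "computable l"
  shows "computable (\<lambda>e. concat (l e))"
proof -
  have "foldl (\<lambda>s x. s @ x) ys xs = ys @ concat xs" for xs and ys :: "'b list"
    by (induction xs arbitrary: ys) simp_all
  then have "concat xs = foldl (\<lambda>s x. s @ x) [] xs" for xs :: "'b list list" by simp
  then show ?thesis by (simp only:) (intro computable_intros assms)
qed

lemma computable_filter [computable_intros]: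
  assumes "computable (\<lambda>p. P (fst p) (snd p))" "computable l"
  shows "computable (\<lambda>e. filter (P e) (l e))"
proof -
  have "filter Q xs = concat (map (\<lambda>x. if Q x then [x] else []) xs)" for Q and xs :: "'b list"
    by (induction xs) simp_all
  then show ?thesis
    by (simp only:) (intro computable_intros assms computable_binary[where h = P])
qed

lemma computable_Ball [computable_intros]:
  assumes "computable (\<lambda>p. P (fst p) (snd p))" "computable l"
  shows "computable (\<lambda>e. \<forall>x\<in>set (l e). P e x)"
proof -
  have "foldl (\<lambda>s x. s \<and> Q x) b xs \<longleftrightarrow> b \<and> (\<forall>x\<in>set xs. Q x)" for Q b and xs :: "'b list"
    by (induction xs arbitrary: b) auto
  then have "(\<forall>x\<in>set xs. Q x) \<longleftrightarrow> foldl (\<lambda>s x. s \<and> Q x) True xs" for Q and xs :: "'b list" by simp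
  then show ?thesis
    by (simp only:) (intro computable_intros assms computable_binary[where h = P])
qed

lemma computable_Bex [computable_intros]:
  assumes "computable (\<lambda>p. P (fst p) (snd p))" "computable l"
  shows "computable (\<lambda>e. \<exists>x\<in>set (l e). P e x)"
  using computable_not[OF computable_Ball[OF computable_not[OF assms(1)] assms(2)]] by simp

lemma computable_length [computable_intros]:
  assumes "computable l"
  shows "computable (\<lambda>e. length (l e))"
proof -
  have "foldl (\<lambda>s x. s + 1) k xs = k + length xs" for k and xs :: "'b list"
    by (induction xs arbitrary: k) simp_all
  then have "length xs = foldl (\<lambda>s x. s + 1) 0 xs" for xs :: "'b list" by simp
  then show ?thesis by (simp only:) (intro computable_intros assms)
qed

lemma computable_upt_length [computable_intros]:
  assumes "computable l"
  shows "computable (\<lambda>e. [0..<length (l e)])"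
proof -
  \<comment> \<open>The length of the accumulator is the next number to append, which saves a
    counter.\<close>
  have "foldl (\<lambda>s x. s @ [length s]) [0..<k] xs = [0..<k + length xs]" for k and xs :: "'b list"
  proof (induction xs arbitrary: k)
    case (Cons x xs)
    then show ?case using Cons.IH[of "Suc k"] by simp
  qed simp
  from this[of 0] have "[0..<length xs] = foldl (\<lambda>s x. s @ [length s]) [] xs" for xs :: "'b list" by simp
  then show ?thesis by (simp only:) (intro computable_intros assms)
qed

lemma computable_nth_default [computable_intros]:
  assumes "computable d" "computable l" "computable i"
  shows "computable (\<lambda>e. nth_default (d e) (l e) (i e))"
proof -
  \<comment> \<open>The pair consists of the current position and the value found so far. The
    starting position \<open>k\<close> is arbitrary for the sake of the induction.\<close>
  have "snd (foldl (\<lambda>s x. (fst s + 1, if fst s = j then x else snd s)) (k, c) xs) =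
      (if k \<le> j then nth_default c xs (j - k) else c)" for j k and c :: 'b and xs
  proof (induction xs arbitrary: k c)
    case (Cons x xs)
    consider "j < k" | "j = k" | "k < j" by linarith
    then show ?case
    proof cases
      case 1
      then show ?thesis using Cons.IH[of "Suc k" c] by simp
    next
      case 2
      then show ?thesis using Cons.IH[of "Suc k" x] by simp
    next
      case 3
      then have "j - k = Suc (j - Suc k)" by simp
      with 3 show ?thesis using Cons.IH[of "Suc k" c] by simp
    qed
  qed simp
  from this[of _ 0] have "nth_default c xs j =
      snd (foldl (\<lambda>s x. (fst s + 1, if fst s = j then x else snd s)) (0, c) xs)" for j and c :: 'b and xs
    by simp
  then show ?thesis
    by (simp only:) (intro computable_intros assms computable_comp[OF assms(3)])
qed

lemma computable_Leaf [computable_intros]: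
  "computable f \<Longrightarrow> computable (\<lambda>x. Leaf (f x))"
  unfolding computable_def encode_pqtree_def encode_nat_def encode_pqtree.simps
  using runs.ConstInt[of 0] by (auto intro: runs.Fork)

lemma computable_QNode [computable_intros]:
  "computable f \<Longrightarrow> computable (\<lambda>x. QNode (f x))"
proof -
  assume "computable f"
  then obtain p where p: "\<And>x. runs p (encode x) (encode (f x))" unfolding computable_def by blast
  have "encode (QNode ts) = Pair (Num (of_int 2)) (encode ts)" for ts
    by (simp add: encode_pqtree_def encode_list_def cong: map_cong)
  then have "runs (Fork (ConstInt 2) p) (encode x) (encode (QNode (f x)))" for x
    using runs.Fork[OF runs.ConstInt p, of 2 x] by (simp only:)
  then show ?thesis unfolding computable_def by blast
qed


section \<open>The exhaustive search\<close>

text \<open>Every round extends all lists by one element and puts the empty list back, so shorter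
  lists are kept. All lengths are wanted because the sizes of the two blocks are not known in
  advance.\<close>

definition lists_upto :: "nat list \<Rightarrow> nat list list" where
  "lists_upto xs = foldl (\<lambda>s _. [] # concat (map (\<lambda>ys. map (\<lambda>y. y # ys) xs) s)) [[]] xs"

lemma set_lists_upto: "set (lists_upto xs) = {ys. set ys \<subseteq> set xs \<and> length ys \<le> length xs}"
proof -
  have step: "set ([] # concat (map (\<lambda>ys. map (\<lambda>y. y # ys) xs) s)) = {ys. set ys \<subseteq> set xs \<and> length ys \<le> Suc k}"
    if "set s = {ys. set ys \<subseteq> set xs \<and> length ys \<le> k}" for s k
  proof (intro equalityI subsetI)
    fix ys assume "ys \<in> {ys. set ys \<subseteq> set xs \<and> length ys \<le> Suc k}"
    then show "ys \<in> set ([] # concat (map (\<lambda>ys. map (\<lambda>y. y # ys) xs) s))"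
      using that by (cases ys) auto
  qed (use that in auto)
  have loop: "set (foldl (\<lambda>s _. [] # concat (map (\<lambda>ys. map (\<lambda>y. y # ys) xs) s)) s zs) =
      {ys. set ys \<subseteq> set xs \<and> length ys \<le> k + length zs}"
    if "set s = {ys. set ys \<subseteq> set xs \<and> length ys \<le> k}" for s k and zs :: "nat list"
    using that
  proof (induction zs arbitrary: s k)
    case (Cons z zs)
    from Cons.IH[OF step[OF Cons.prems]] show ?case by simp
  qed simp
  have "set [[]] = {ys. set ys \<subseteq> set xs \<and> length ys \<le> 0}" by auto
  from loop[OF this, of xs] show ?thesis unfolding lists_upto_def by (simp only: add_0)
qed

lemma computable_lists_upto [computable_intros]:
  assumes "computable l"
  shows "computable (\<lambda>e. lists_upto (l e))"
proof (rule computable_comp[OF _ assms])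
  show "computable lists_upto" unfolding lists_upto_def by (intro computable_intros)
qed

definition entry :: "real list list \<Rightarrow> nat \<Rightarrow> nat \<Rightarrow> real" where
  "entry M a b = nth_default 0 (nth_default [] M a) b"

text \<open>All quantifiers range over lists, as the computability rules require. Equal length
  together with surjectivity yields distinctness by the pigeonhole principle.\<close>

definition valid_order :: "real list list \<Rightarrow> nat list \<Rightarrow> bool" where
  "valid_order M xs \<longleftrightarrow> length xs = length M \<and>
     (\<forall>i \<in> set [0..<length M]. \<exists>x \<in> set xs. x = i) \<and>
     (\<forall>i \<in> set [0..<length M]. \<forall>j \<in> set [0..<length M]. \<forall>k \<in> set [0..<length M]. \<forall>l \<in> set [0..<length M].
        i < j \<and> j < k \<and> k < l \<longrightarrow>
        robinson4 (entry M) (nth_default 0 xs i) (nth_default 0 xs j) (nth_default 0 xs k) (nth_default 0 xs l))"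

lemma computable_entry [computable_intros]:
  "computable M \<Longrightarrow> computable a \<Longrightarrow> computable b \<Longrightarrow> computable (\<lambda>e. entry (M e) (a e) (b e))"
  unfolding entry_def by (intro computable_intros)

text \<open>Comparing a minimum is rewritten as a disjunction of comparisons, so that
  \<open>Less\<close> suffices.\<close>

lemma computable_robinson4 [computable_intros]:
  "computable M \<Longrightarrow> computable a \<Longrightarrow> computable b \<Longrightarrow> computable c \<Longrightarrow> computable d \<Longrightarrow>
     computable (\<lambda>e. robinson4 (entry (M e)) (a e) (b e) (c e) (d e))"
  unfolding robinson4_def min_less_iff_disj by (intro computable_intros)

lemma computable_valid_order [computable_intros]:
  assumes "computable M" "computable xs"
  shows "computable (\<lambda>e. valid_order (M e) (xs e))"
proof (rule computable_binary[where h = valid_order, OF _ assms])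
  show "computable (\<lambda>p. valid_order (fst p) (snd p))"
    unfolding valid_order_def by (intro computable_intros)
qed

definition candidates :: "real list list \<Rightarrow> (nat list \<times> nat list) list" where
  "candidates M = concat (map (\<lambda>us. map (\<lambda>vs. (us, vs)) (lists_upto [0..<length M])) (lists_upto [0..<length M]))"

text \<open>
  Candidates in which both blocks have at least two elements come last, so that the last candidate
  is one of them whenever there are any; \<open>find_block\<close> takes the last candidate.
\<close>

definition block_candidates :: "real list list \<Rightarrow> (nat list \<times> nat list) list" where
  "block_candidates M =
     filter (\<lambda>p. length (fst p) = 1 \<and> valid_order M (fst p @ snd p)) (candidates M) @
     filter (\<lambda>p. 1 < length (fst p) \<and> 1 < length (snd p) \<and>
       valid_order M (fst p @ snd p) \<and> valid_order M (rev (fst p) @ snd p)) (candidates M)"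

definition find_block :: "real list list \<Rightarrow> nat list \<times> nat list" where
  "find_block M = foldl (\<lambda>_ p. p) ([], []) (block_candidates M)"

lemma find_block_eq_last: "block_candidates M \<noteq> [] \<Longrightarrow> find_block M = last (block_candidates M)"
proof -
  have "foldl (\<lambda>_ p. p) q ps = last (q # ps)" for q and ps :: "(nat list \<times> nat list) list"
    by (induction ps arbitrary: q) auto
  then show "block_candidates M \<noteq> [] \<Longrightarrow> find_block M = last (block_candidates M)"
    unfolding find_block_def by simp
qed

lemma computable_find_block: "computable find_block"
  unfolding find_block_def block_candidates_def candidates_def by (intro computable_intros)

lemma valid_order_iff:
  "valid_order M xs \<longleftrightarrow>
     distinct xs \<and> set xs = {..<length M} \<and> robinson_order (entry M) xs"
proof -
  have perm: "length xs = length M \<and> (\<forall>i \<in> set [0..<length M]. \<exists>x \<in> set xs. x = i) \<longleftrightarrow>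
      distinct xs \<and> set xs = {..<length M}"
  proof
    assume *: "length xs = length M \<and> (\<forall>i \<in> set [0..<length M]. \<exists>x \<in> set xs. x = i)"
    then have "{..<length M} \<subseteq> set xs" by auto
    moreover have "card (set xs) \<le> card {..<length M}" using * card_length[of xs] by simp
    ultimately have "{..<length M} = set xs" by (intro card_seteq) simp_all
    with * show "distinct xs \<and> set xs = {..<length M}" by (metis card_distinct card_lessThan)
  next
    assume "distinct xs \<and> set xs = {..<length M}"
    then show "length xs = length M \<and> (\<forall>i \<in> set [0..<length M]. \<exists>x \<in> set xs. x = i)"
      by (metis atLeast_upt card_lessThan distinct_card)
  qed
  have "(\<forall>i \<in> set [0..<length M]. \<forall>j \<in> set [0..<length M]. \<forall>k \<in> set [0..<length M]. \<forall>l \<in> set [0..<length M].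
        i < j \<and> j < k \<and> k < l \<longrightarrow>
        robinson4 (entry M) (nth_default 0 xs i) (nth_default 0 xs j) (nth_default 0 xs k) (nth_default 0 xs l)) \<longleftrightarrow>
      robinson_order (entry M) xs" (is "?L \<longleftrightarrow> _") if len: "length xs = length M"
  proof
    assume L: ?L
    show "robinson_order (entry M) xs"
      unfolding robinson_order_iff_nth
    proof (intro allI impI, elim conjE)
      fix i j k l assume "i < j" "j < k" "k < l" "l < length xs"
      with L[rule_format, of i j k l] len
      show "robinson4 (entry M) (xs ! i) (xs ! j) (xs ! k) (xs ! l)"
        by (simp add: nth_default_nth)
    qed
  next
    assume "robinson_order (entry M) xs"
    then show ?L
      using len unfolding robinson_order_iff_nth by (simp add: nth_default_nth)
  qed
  with perm show ?thesis unfolding valid_order_def by blast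
qed

lemma mem_candidates:
  assumes "valid_order M (us @ vs)"
  shows "(us, vs) \<in> set (candidates M)"
proof -
  have "distinct (us @ vs)" "set (us @ vs) = {..<length M}"
    using assms unfolding valid_order_iff by blast+
  moreover from this have "length us + length vs = length M"
    by (metis card_lessThan distinct_card length_append)
  ultimately have "us \<in> set (lists_upto [0..<length M])" "vs \<in> set (lists_upto [0..<length M])"
    by (auto simp: set_lists_upto)
  then show ?thesis unfolding candidates_def by auto
qed

text \<open>Cutting off the first point of the valid order \<open>zs\<close> gives a member of
  \<open>single\<close>, so a last candidate exists. If it comes from \<open>double\<close>,
  \<open>robinson_orders_with_flip\<close> applies. If \<open>double\<close> is empty, two
  inequivalent valid orders would be related by a flip, whose two arcs would be a member of
  \<open>double\<close>; so there is one order only, and the reversal of a one-point block returns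
  it unchanged.\<close>

lemma find_block_correct:
  assumes "symmetric_function (entry M)" "M \<noteq> []" and zs: "valid_order M zs"
    and block: "find_block M = (us, vs)"
  shows "us \<noteq> []" "valid_order M (us @ vs)" "valid_order M (rev us @ vs)"
    "\<And>ws. valid_order M ws \<Longrightarrow> ws \<simeq> us @ vs \<or> ws \<simeq> rev us @ vs"
proof -
  interpret symmetric_function "entry M" by (rule assms(1))
  define single where "single = filter (\<lambda>p. length (fst p) = 1 \<and> valid_order M (fst p @ snd p)) (candidates M)"
  define double where "double = filter (\<lambda>p. 1 < length (fst p) \<and> 1 < length (snd p) \<and>
       valid_order M (fst p @ snd p) \<and> valid_order M (rev (fst p) @ snd p)) (candidates M)"
  have blocks: "block_candidates M = single @ double"
    unfolding block_candidates_def single_def double_def ..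
  have "set zs \<noteq> {}" using zs assms(2) by (auto simp: valid_order_iff lessThan_empty_iff)
  then obtain x xs where x: "zs = [x] @ xs" by (metis append_Cons append_Nil neq_Nil_conv set_empty)
  then have "([x], xs) \<in> set single"
    using zs mem_candidates[of M "[x]" xs] unfolding single_def by simp
  then have single: "single \<noteq> []" by (metis list.set(1) empty_iff)
  then have last: "last (single @ double) = (us, vs)"
    using find_block_eq_last[of M] unfolding blocks block by simp
  have "us \<noteq> [] \<and> valid_order M (us @ vs) \<and> valid_order M (rev us @ vs) \<and>
    (\<forall>ws. valid_order M ws \<longrightarrow> ws \<simeq> us @ vs \<or> ws \<simeq> rev us @ vs)"
  proof (cases "double = []")
    case False
    then have "(us, vs) \<in> set double" using last by (metis last_appendR last_in_set)
    then have uv: "1 < length us" "1 < length vs" "valid_order M (us @ vs)" "valid_order M (rev us @ vs)"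
      by (simp_all add: double_def)
    have "ws \<simeq> us @ vs \<or> ws \<simeq> rev us @ vs" if "valid_order M ws" for ws
      using uv that robinson_orders_with_flip[of us vs ws] unfolding valid_order_iff by simp
    with uv show ?thesis by auto
  next
    case True
    then have "(us, vs) \<in> set single" using last single by (metis append_Nil2 last_in_set)
    then have uv: "length us = 1" "valid_order M (us @ vs)" by (simp_all add: single_def)
    have "ws \<simeq> us @ vs" if ws: "valid_order M ws" for ws
    proof (rule ccontr)
      assume "\<not> ws \<simeq> us @ vs"
      then have "flip_equiv ws (us @ vs)"
        using robinson_orders_flip_equiv[of ws "us @ vs"] ws uv(2) unfolding valid_order_iff by simp
      then obtain us' vs' where *: "2 \<le> length us'" "2 \<le> length vs'" "ws \<simeq> us' @ vs'" "us @ vs \<simeq> rev us' @ vs'"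
        unfolding flip_equiv_def by blast
      have "valid_order M (us' @ vs')" "valid_order M (rev us' @ vs')"
        using ws uv(2) dihedral_equiv_distinct[OF *(3)] dihedral_equiv_set[OF *(3)] robinson_order_cong[OF *(3)]
          dihedral_equiv_distinct[OF *(4)] dihedral_equiv_set[OF *(4)] robinson_order_cong[OF *(4)]
        unfolding valid_order_iff by blast+
      with *(1,2) mem_candidates have "(us', vs') \<in> set double" by (simp add: double_def)
      with True show False by simp
    qed
    moreover have "rev us = us" using uv(1) by (cases us) auto
    ultimately show ?thesis using uv by auto
  qed
  then show "us \<noteq> []" "valid_order M (us @ vs)" "valid_order M (rev us @ vs)"
    "\<And>ws. valid_order M ws \<Longrightarrow> ws \<simeq> us @ vs \<or> ws \<simeq> rev us @ vs" by simp_all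
qed

lemma encode_mat_to_list: "encode (mat_to_list D) = encode_mat D"
proof -
  have "encode = (\<lambda>row. encode_list (map Num row))"
    by (auto simp: encode_list_def encode_real_def cong: map_cong)
  then show ?thesis unfolding encode_mat_def by (simp add: encode_list_def)
qed

lemma entry_mat_to_list:
  assumes "D \<in> carrier_mat n n"
  shows "entry (mat_to_list D) = entries n D"
  using assms
  by (intro ext) (auto simp: entry_def entries_def mat_to_list_def nth_default_def)

definition block_algorithm :: "real list list \<Rightarrow> pqtree" where
  "block_algorithm M = block_tree (fst (find_block M)) (snd (find_block M))"

lemma computable_block_algorithm: "computable block_algorithm"
  unfolding block_algorithm_def block_tree_def
  by (intro computable_intros computable_find_block)

theorem theorem5p17:
  shows "\<exists>alg :: program. \<forall>(n::nat) > 0. \<forall>D. pre_strict_circular_robinson n D \<longrightarrow>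
    (\<exists>t. runs alg (encode_mat D) (encode_pqtree t) \<and> pq_tree_on n t \<and>
      strict_circular_orderings n D = {\<rho> \<circ> \<pi> | \<rho> \<pi>. \<rho> \<in> dihedral n \<and> \<pi> \<in> pq_perms n t})"
proof -
  obtain alg where alg: "\<And>M. runs alg (encode M) (encode (block_algorithm M))"
    using computable_block_algorithm unfolding computable_def by blast
  show ?thesis
  proof (intro exI[of _ alg] allI impI)
    fix n :: nat and D
    assume n: "0 < n" and pre: "pre_strict_circular_robinson n D"
    note D = pre_strict_circular_robinsonD[OF pre]
    define M where "M = mat_to_list D"
    obtain us vs where block: "find_block M = (us, vs)" by fastforce
    have carrier: "D \<in> carrier_mat n n" using D(1) by (simp add: dissimilarity_mat_def)
    then have M: "length M = n" "entry M = entries n D"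
      unfolding M_def by (simp add: mat_to_list_def, rule entry_mat_to_list)
    from D(2) obtain \<sigma> where "\<sigma> \<in> strict_circular_orderings n D" by blast
    then have "valid_order M (sequence_of n \<sigma>)"
      using set_sequence_of distinct_sequence_of
      unfolding valid_order_iff strict_circular_orderings_iff[OF D(1)] M by blast
    moreover have "symmetric_function (entry M)" unfolding M by (rule symmetric_entries[OF D(1)])
    moreover have "M \<noteq> []" using M n by auto
    ultimately have correct: "us \<noteq> []" "valid_order M (us @ vs)" "valid_order M (rev us @ vs)"
      "\<And>ws. valid_order M ws \<Longrightarrow> ws \<simeq> us @ vs \<or> ws \<simeq> rev us @ vs"
      using find_block_correct[of M _ us vs] block by blast+
    note correct' = correct(2-)[unfolded valid_order_iff M]
    have "runs alg (encode_mat D) (encode_pqtree (block_tree us vs))"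
      using alg[of M] by (simp add: M_def[symmetric] block_algorithm_def block encode_pqtree_def
          encode_mat_to_list[symmetric])
    moreover have "pq_tree_on n (block_tree us vs)"
      using correct(1) correct'(1) by (intro pq_tree_on_block_tree) simp_all
    moreover have "strict_circular_orderings n D =
        {\<rho> \<circ> \<pi> | \<rho> \<pi>. \<rho> \<in> dihedral n \<and> \<pi> \<in> pq_perms n (block_tree us vs)}"
      using correct'(1,2) by (intro strict_circular_orderings_block_tree[OF D(1)] correct'(3)) simp_all
    ultimately show "\<exists>t. runs alg (encode_mat D) (encode_pqtree t) \<and> pq_tree_on n t \<and>
      strict_circular_orderings n D = {\<rho> \<circ> \<pi> | \<rho> \<pi>. \<rho> \<in> dihedral n \<and> \<pi> \<in> pq_perms n t}"
      by blast
  qed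
qed

end
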